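(* Let $(X,f)$ be a non-wandering Smale space. Then $(X,f)$ is surjunctive (every injective endomorphism of $(X,f)$ is surjective) and $(X,f)$ has the Moore property (every surjective endomorphism of $(X,f)$ is pre-injective).
   Context: A dynamical system is a pair $(X,f)$ where $X$ is a compact metrizable space and $f\colon X\to X$ is a homeomorphism. Fix any compatible metric $d$ on $X$ (by compactness none of the notions below depends on the choice of $d$). $f$ is expansive if there is $\eta>0$ such that for all distinct $x,y\in X$ there is $n\in\mathbb{Z}$ with $d(f^n(x),f^n(y))>\eta$. For $\delta>0$, a $\delta$-pseudo-orbit is a sequence $(u_n)_{n\in\mathbb{Z}}$ in $X$ with $d(u_{n+1},f(u_n))\le\delta$ for all $n\in\mathbb{Z}$. It is $\varepsilon$-traced by the orbit of $x\in X$ if $d(u_n,f^n(x))\le\varepsilon$ for all $n\in\mathbb{Z}$. $(X,f)$ has the pseudo-orbit tracing property if for every $\varepsilon>0$ there is $\delta>0$ such that every $\delta$-pseudo-orbit in $X$ is $\varepsilon$-traced by the orbit of some point of $X$. A Smale space is a dynamical system $(X,f)$ such that $f$ is expansive and has the pseudo-orbit tracing property. A point $x\in X$ is non-wandering if for every neighborhood $U$ of $x$ there is an integer $n\ge 1$ with $U\cap f^n(U)\neq\varnothing$. $(X,f)$ is non-wandering if every point of $X$ is non-wandering. An endomorphism of $(X,f)$ is a continuous map $\tau\colon X\to X$ with $\tau\circ f=f\circ\tau$. Two points $x,y\in X$ are homoclinic if $d(f^n(x),f^n(y))\to 0$ as $|n|\to\infty$; this is an equivalence relation. An endomorphism is pre-injective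 if its restriction to every homoclinicity class is injective. *)

theory Defs
  imports "HOL-Analysis.Analysis"
begin

text \<open>
  The phase space is a compact subset \<open>X\<close> of a metric type, with the metric of that type as the
  chosen compatible metric (every compact metrizable space is homeomorphic to such a set).
  Maps are HOL functions of which only the values on \<open>X\<close> matter.
\<close>

definition dynamical_system :: "'a::metric_space set \<Rightarrow> ('a \<Rightarrow> 'a) \<Rightarrow> bool" where
  "dynamical_system X f \<longleftrightarrow> compact X \<and> (\<exists>g. homeomorphism X X f g)"

text \<open>The inverse of \<open>f\<close> is taken on \<open>X\<close>, since \<open>f\<close> need not be injective as a function on the
  whole type.\<close>

definition iter :: "'a set \<Rightarrow> ('a \<Rightarrow> 'a) \<Rightarrow> int \<Rightarrow> 'a \<Rightarrow> 'a" where
  "iter X f n = (if n \<ge> 0 then f ^^ nat n else inv_into X f ^^ nat (- n))"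

definition expansive :: "'a::metric_space set \<Rightarrow> ('a \<Rightarrow> 'a) \<Rightarrow> bool" where
  "expansive X f \<longleftrightarrow>
     (\<exists>\<eta>>0. \<forall>x\<in>X. \<forall>y\<in>X. x \<noteq> y \<longrightarrow> (\<exists>n. dist (iter X f n x) (iter X f n y) > \<eta>))"

definition pseudo_orbit :: "'a::metric_space set \<Rightarrow> ('a \<Rightarrow> 'a) \<Rightarrow> real \<Rightarrow> (int \<Rightarrow> 'a) \<Rightarrow> bool" where
  "pseudo_orbit X f \<delta> u \<longleftrightarrow> (\<forall>n. u n \<in> X) \<and> (\<forall>n. dist (u (n + 1)) (f (u n)) \<le> \<delta>)"

definition traced_by ::
  "'a::metric_space set \<Rightarrow> ('a \<Rightarrow> 'a) \<Rightarrow> real \<Rightarrow> (int \<Rightarrow> 'a) \<Rightarrow> 'a \<Rightarrow> bool" where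
  "traced_by X f \<epsilon> u x \<longleftrightarrow> (\<forall>n. dist (u n) (iter X f n x) \<le> \<epsilon>)"

definition pseudo_orbit_tracing_property :: "'a::metric_space set \<Rightarrow> ('a \<Rightarrow> 'a) \<Rightarrow> bool" where
  "pseudo_orbit_tracing_property X f \<longleftrightarrow>
     (\<forall>\<epsilon>>0. \<exists>\<delta>>0. \<forall>u. pseudo_orbit X f \<delta> u \<longrightarrow> (\<exists>x\<in>X. traced_by X f \<epsilon> u x))"

definition smale_space :: "'a::metric_space set \<Rightarrow> ('a \<Rightarrow> 'a) \<Rightarrow> bool" where
  "smale_space X f \<longleftrightarrow>
     dynamical_system X f \<and> expansive X f \<and> pseudo_orbit_tracing_property X f"

definition nbhd_in :: "'a::topological_space set \<Rightarrow> 'a \<Rightarrow> 'a set \<Rightarrow> bool" where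
  "nbhd_in X x U \<longleftrightarrow> U \<subseteq> X \<and> (\<exists>V. openin (top_of_set X) V \<and> x \<in> V \<and> V \<subseteq> U)"

definition non_wandering_point :: "'a::topological_space set \<Rightarrow> ('a \<Rightarrow> 'a) \<Rightarrow> 'a \<Rightarrow> bool" where
  "non_wandering_point X f x \<longleftrightarrow>
     (\<forall>U. nbhd_in X x U \<longrightarrow> (\<exists>n\<ge>1. U \<inter> (f ^^ n) ` U \<noteq> {}))"

definition non_wandering :: "'a::topological_space set \<Rightarrow> ('a \<Rightarrow> 'a) \<Rightarrow> bool" where
  "non_wandering X f \<longleftrightarrow> (\<forall>x\<in>X. non_wandering_point X f x)"

definition endomorphism ::
  "'a::topological_space set \<Rightarrow> ('a \<Rightarrow> 'a) \<Rightarrow> ('a \<Rightarrow> 'a) \<Rightarrow> bool" where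
  "endomorphism X f \<tau> \<longleftrightarrow>
     continuous_on X \<tau> \<and> \<tau> ` X \<subseteq> X \<and> (\<forall>x\<in>X. \<tau> (f x) = f (\<tau> x))"

text \<open>The filter \<open>filtercomap abs at_top\<close> on the integers expresses \<open>\<bar>n\<bar> \<rightarrow> \<infinity>\<close>.\<close>

definition homoclinic :: "'a::metric_space set \<Rightarrow> ('a \<Rightarrow> 'a) \<Rightarrow> 'a \<Rightarrow> 'a \<Rightarrow> bool" where
  "homoclinic X f x y \<longleftrightarrow>
     ((\<lambda>n::int. dist (iter X f n x) (iter X f n y)) \<longlongrightarrow> 0) (filtercomap abs at_top)"

definition homoclinicity_class :: "'a::metric_space set \<Rightarrow> ('a \<Rightarrow> 'a) \<Rightarrow> 'a \<Rightarrow> 'a set" where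
  "homoclinicity_class X f x = {y \<in> X. homoclinic X f x y}"

definition pre_injective ::
  "'a::metric_space set \<Rightarrow> ('a \<Rightarrow> 'a) \<Rightarrow> ('a \<Rightarrow> 'a) \<Rightarrow> bool" where
  "pre_injective X f \<tau> \<longleftrightarrow> (\<forall>x\<in>X. inj_on \<tau> (homoclinicity_class X f x))"

definition surjunctive :: "'a::topological_space set \<Rightarrow> ('a \<Rightarrow> 'a) \<Rightarrow> bool" where
  "surjunctive X f \<longleftrightarrow> (\<forall>\<tau>. endomorphism X f \<tau> \<longrightarrow> inj_on \<tau> X \<longrightarrow> \<tau> ` X = X)"

definition moore_property :: "'a::metric_space set \<Rightarrow> ('a \<Rightarrow> 'a) \<Rightarrow> bool" where
  "moore_property X f \<longleftrightarrow> (\<forall>\<tau>. endomorphism X f \<tau> \<longrightarrow> \<tau> ` X = X \<longrightarrow> pre_injective X f \<tau>)"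

end

theory Submission
  imports Defs
begin

text \<open>
  Periodic points of period \<open>s\<close> form a finite set which an injective endomorphism must permute, and
  periodic points are dense; this gives surjunctivity.

  For the Moore property, call \<open>a\<close> and \<open>b\<close> equivalent if for every \<open>d > 0\<close> they are joined by a
  \<open>d\<close>-chain of length divisible by \<open>s\<close>. Chain recurrence makes this an equivalence relation,
  shadowing makes its finitely many classes open, and on the class of a point of period \<open>s\<close> chains
  of one fixed length join any two points. A power \<open>g\<close> of a surjective endomorphism maps a given
  class \<open>D\<close> onto itself. Suppose \<open>g x = g y\<close> with \<open>x \<in> D\<close> and \<open>y \<noteq> x\<close> homoclinic to \<open>x\<close>, and cut
  \<open>N\<close> long time windows. Lift a maximal separated set \<open>E \<subseteq> D\<close> through \<open>g\<close>; replacing excursions near \<open>x\<close> by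
  excursions near \<open>y\<close>, the lifts can be chosen not to follow \<open>x\<close> in the middle of any window. Now insert an
  excursion near \<open>x\<close> in one of the windows. The \<open>N \<cdot> card E\<close> resulting points are distinguished by
  their nearest point in \<open>E\<close> and boundedly many further data, which is absurd for large \<open>N\<close>.
\<close>

section \<open>Orbits of homeomorphisms of compact sets\<close>

locale compact_homeo =
  fixes X :: "'a::metric_space set" and f :: "'a \<Rightarrow> 'a"
  assumes dyn: "dynamical_system X f"
begin

abbreviation orb :: "int \<Rightarrow> 'a \<Rightarrow> 'a" where "orb \<equiv> iter X f"

lemma compact_X: "compact X"
  using dyn by (simp add: dynamical_system_def)

lemma bij_f: "bij_betw f X X"
  using dyn unfolding dynamical_system_def homeomorphism_def bij_betw_def
  by (metis inj_on_def)

lemma continuous_f: "continuous_on X f"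
  using dyn by (auto simp: dynamical_system_def homeomorphism_def)

lemma continuous_inv: "continuous_on X (inv_into X f)"
proof -
  obtain g where g: "homeomorphism X X f g"
    using dyn by (auto simp: dynamical_system_def)
  have "inv_into X f x = g x" if "x \<in> X" for x
    using g that bij_f unfolding homeomorphism_def
    by (metis bij_betw_inv_into_left imageI)
  then show ?thesis
    using g by (simp add: homeomorphism_def cong: continuous_on_cong)
qed

lemma f_in: "x \<in> X \<Longrightarrow> f x \<in> X"
  using bij_f by (auto simp: bij_betw_def)

lemma inv_in: "x \<in> X \<Longrightarrow> inv_into X f x \<in> X"
  using bij_f by (metis bij_betw_def inv_into_into)

lemma f_eqD: "\<lbrakk>f x = f y; x \<in> X; y \<in> X\<rbrakk> \<Longrightarrow> x = y"
  using bij_f by (auto simp: bij_betw_def inj_on_def)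

lemma funpow_in: "(\<And>x. x \<in> X \<Longrightarrow> h x \<in> X) \<Longrightarrow> x \<in> X \<Longrightarrow> (h ^^ n) x \<in> X"
  by (induction n) auto

lemma funpow_continuous:
  assumes "continuous_on X h" "\<And>x. x \<in> X \<Longrightarrow> h x \<in> X"
  shows "continuous_on X (h ^^ n)"
proof (induction n)
  case 0
  show ?case by (simp add: id_def)
next
  case (Suc n)
  have "continuous_on X (h \<circ> h ^^ n)"
    using Suc assms funpow_in[of h]
    by (intro continuous_on_compose continuous_on_subset[OF assms(1)]) auto
  then show ?case by simp
qed

lemma orb_in: "x \<in> X \<Longrightarrow> orb n x \<in> X"
  by (simp add: iter_def funpow_in f_in inv_in)

lemma continuous_orb: "continuous_on X (orb n)"
  by (auto simp: iter_def intro!: funpow_continuous continuous_f continuous_inv f_in inv_in)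

lemma orb_0: "orb 0 x = x"
  by (simp add: iter_def)

lemma orb_Suc:
  assumes "x \<in> X"
  shows "orb (n + 1) x = f (orb n x)"
proof (cases "n \<ge> 0")
  case True
  then have "nat (n + 1) = Suc (nat n)" by simp
  then show ?thesis using True by (simp add: iter_def)
next
  case False
  let ?h = "inv_into X f"
  have k: "nat (- n) = Suc (nat (- n - 1))" using False by simp
  have "f (orb n x) = f (?h ((?h ^^ nat (- n - 1)) x))"
    using False k by (simp add: iter_def)
  also have "\<dots> = (?h ^^ nat (- n - 1)) x"
    using bij_f funpow_in[of ?h x] assms inv_in by (metis bij_betw_inv_into_right)
  also have "\<dots> = orb (n + 1) x"
    using False by (auto simp: iter_def)
  finally show ?thesis ..
qed

text \<open>Identities between orbits reduce to checking the recurrence, without a case split on the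
  sign of the time. The backward step rests on injectivity of \<open>f\<close> on
  \<open>X\<close>.\<close>

lemma orb_unique:
  assumes "\<And>n. u n \<in> X" "\<And>n. u (n + 1) = f (u n)"
  shows "u n = orb n (u 0)"
proof (induction n rule: int_induct[where k = 0])
  case base
  show ?case by (simp add: orb_0)
next
  case (step1 i)
  then show ?case using assms orb_Suc by simp
next
  case (step2 i)
  have "f (u (i - 1)) = f (orb (i - 1) (u 0))"
    using step2 assms(2)[of "i - 1"] orb_Suc[of "u 0" "i - 1"] assms(1) by simp
  then show ?case using f_eqD assms(1) orb_in by blast
qed

lemma orb_add:
  assumes "x \<in> X"
  shows "orb (m + n) x = orb m (orb n x)"
proof -
  have "orb (k + 1 + n) x = f (orb (k + n) x)" for k
    using orb_Suc[OF assms, of "k + n"] by (simp add: ac_simps)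
  then show ?thesis
    using orb_unique[of "\<lambda>k. orb (k + n) x" m] assms orb_in by simp
qed

lemma orb_commute:
  assumes "endomorphism X f \<tau>" "x \<in> X"
  shows "\<tau> (orb n x) = orb n (\<tau> x)"
  using orb_unique[of "\<lambda>k. \<tau> (orb k x)" n] assms orb_in[of x] orb_Suc[of x]
  by (auto simp: endomorphism_def orb_0)

section \<open>Uniform continuity, finite nets and finite codes for orbit segments\<close>

lemma uniform_modulus:
  assumes "continuous_on X (h :: 'a \<Rightarrow> 'a)" "e > 0"
  obtains d where "d > 0" "\<And>x y. \<lbrakk>x \<in> X; y \<in> X; dist x y \<le> d\<rbrakk> \<Longrightarrow> dist (h x) (h y) \<le> e"
proof -
  have "uniformly_continuous_on X h"
    using assms compact_X compact_uniformly_continuous by blast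
  then obtain d where d: "d > 0"
    "\<forall>x\<in>X. \<forall>y\<in>X. dist y x < d \<longrightarrow> dist (h y) (h x) < e"
    using assms(2) unfolding uniformly_continuous_on_def by meson
  show thesis
    by (rule that[of "d / 2"]) (use d in \<open>force intro: less_imp_le\<close>)+
qed

lemma orb_modulus:
  assumes "e > 0"
  obtains d where "d > 0"
    "\<And>x y j. \<lbrakk>x \<in> X; y \<in> X; dist x y \<le> d; \<bar>j\<bar> \<le> int k\<rbrakk> \<Longrightarrow> dist (orb j x) (orb j y) \<le> e"
proof -
  have "\<exists>d>0. \<forall>x\<in>X. \<forall>y\<in>X. dist x y \<le> d \<longrightarrow> dist (orb j x) (orb j y) \<le> e" for j
    using uniform_modulus[OF continuous_orb assms] by metis
  then obtain d where d: "\<And>j. d j > 0"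
    "\<And>j x y. \<lbrakk>x \<in> X; y \<in> X; dist x y \<le> d j\<rbrakk> \<Longrightarrow> dist (orb j x) (orb j y) \<le> e"
    by metis
  let ?J = "{- int k..int k}"
  have fin: "finite (d ` ?J)" "d ` ?J \<noteq> {}" by auto
  show thesis
  proof (rule that[of "Min (d ` ?J)"])
    show "Min (d ` ?J) > 0" using fin d(1) by (subst Min_gr_iff) auto
    fix x y j assume *: "x \<in> X" "y \<in> X" "dist x y \<le> Min (d ` ?J)" "\<bar>j\<bar> \<le> int k"
    have "Min (d ` ?J) \<le> d j" using *(4) by (intro Min_le imageI) auto
    then have "dist x y \<le> d j" using *(3) by linarith
    then show "dist (orb j x) (orb j y) \<le> e" using d(2) * by blast
  qed
qed

lemma finite_net:
  assumes "A \<subseteq> X" "e > 0"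
  obtains K where "finite K" "K \<subseteq> A" "\<And>a. a \<in> A \<Longrightarrow> \<exists>c\<in>K. dist a c \<le> e"
proof -
  obtain K0 where K0: "finite K0" "X \<subseteq> (\<Union>x\<in>K0. ball x (e / 2))"
    using compact_X assms(2) compact_eq_totally_bounded[of X] by (metis half_gt_zero)
  \<comment> \<open>Total boundedness gives centres that may lie outside \<open>A\<close>. Each
    centre whose ball of radius \<open>e / 2\<close> meets \<open>A\<close> is exchanged for a point
    of \<open>A\<close> in that ball.\<close>
  define s where "s c = (SOME a. a \<in> A \<and> dist c a < e / 2)" for c
  let ?C = "{c\<in>K0. \<exists>a\<in>A. dist c a < e / 2}"
  have s: "s c \<in> A \<and> dist c (s c) < e / 2" if "c \<in> ?C" for c
    unfolding s_def by (rule someI_ex) (use that in auto)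
  show thesis
  proof (rule that[of "s ` ?C"])
    show "finite (s ` ?C)" using K0 by simp
    show "s ` ?C \<subseteq> A" using s by blast
    fix a assume a: "a \<in> A"
    then obtain c where c: "c \<in> K0" "dist c a < e / 2"
      using K0 assms by (auto simp: ball_def)
    then have "c \<in> ?C" using a by auto
    then have "dist a (s c) \<le> e"
      using s[of c] c dist_triangle[of a "s c" c] by (simp add: dist_commute)
    then show "\<exists>c\<in>s ` ?C. dist a c \<le> e" using \<open>c \<in> ?C\<close> by blast
  qed
qed

text \<open>A finite code turns closeness of orbit segments into equality of labels, so that
  compactness can be exploited by counting.\<close>

lemma orbit_coding:
  assumes "e > 0"
  obtains P :: "'a set" and h where "finite P" "\<And>x. x \<in> X \<Longrightarrow> h x \<in> P"
    "\<And>x y j. \<lbrakk>x \<in> X; y \<in> X; h x = h y; \<bar>j\<bar> \<le> int k\<rbrakk> \<Longrightarrow> dist (orb j x) (orb j y) \<le> e"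
proof -
  obtain d where d: "d > 0"
    "\<And>x y j. \<lbrakk>x \<in> X; y \<in> X; dist x y \<le> d; \<bar>j\<bar> \<le> int k\<rbrakk> \<Longrightarrow> dist (orb j x) (orb j y) \<le> e"
    using orb_modulus[OF assms] by metis
  obtain P where P: "finite P" "P \<subseteq> X" "\<And>a. a \<in> X \<Longrightarrow> \<exists>c\<in>P. dist a c \<le> d / 2"
    using finite_net[of X "d / 2"] d(1) by auto
  then obtain h where h: "\<And>a. a \<in> X \<Longrightarrow> h a \<in> P \<and> dist a (h a) \<le> d / 2"
    by metis
  show thesis
  proof (rule that[of P h])
    fix x y j assume *: "x \<in> X" "y \<in> X" "h x = h y" "\<bar>j\<bar> \<le> int k"
    then have "dist x y \<le> d"
      using h[of x] h[of y] dist_triangle[of x y "h x"] by (simp add: dist_commute)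
    then show "dist (orb j x) (orb j y) \<le> e" using d * by blast
  qed (use P h in auto)
qed

text \<open>Codes are injective on a separated set, which bounds its cardinality. A separated set of
  greatest cardinality also spans, since a point far from all its elements could be added to
  it.\<close>

lemma maximal_separated:
  assumes "D \<subseteq> X" "e > 0"
  obtains E where "finite E" "E \<subseteq> D"
    "\<And>a b. \<lbrakk>a \<in> E; b \<in> E; \<And>t. 0 \<le> t \<Longrightarrow> t < int n \<Longrightarrow> dist (orb t a) (orb t b) \<le> e\<rbrakk> \<Longrightarrow> a = b"
    "\<And>a. a \<in> D \<Longrightarrow> \<exists>b\<in>E. \<forall>t. 0 \<le> t \<longrightarrow> t < int n \<longrightarrow> dist (orb t a) (orb t b) \<le> e"
proof -
  define close where
    "close a b \<longleftrightarrow> (\<forall>t. 0 \<le> t \<longrightarrow> t < int n \<longrightarrow> dist (orb t a) (orb t b) \<le> e)" for a b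
  define sep where
    "sep E \<longleftrightarrow> E \<subseteq> D \<and> (\<forall>a\<in>E. \<forall>b\<in>E. close a b \<longrightarrow> a = b)" for E
  obtain P :: "'a set" and h where P: "finite P" "\<And>x. x \<in> X \<Longrightarrow> h x \<in> P"
    "\<And>x y j. \<lbrakk>x \<in> X; y \<in> X; h x = h y; \<bar>j\<bar> \<le> int n\<rbrakk> \<Longrightarrow> dist (orb j x) (orb j y) \<le> e"
    by (rule orbit_coding[OF assms(2), of n]) blast
  have bound: "finite E \<and> card E \<le> card P" if "sep E" for E
  proof -
    have E: "E \<subseteq> X" using that assms(1) by (auto simp: sep_def)
    have "inj_on h E"
    proof (rule inj_onI)
      fix a b assume *: "a \<in> E" "b \<in> E" "h a = h b"
      have "close a b" unfolding close_def
        using * E by (intro allI impI P(3)) auto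
      then show "a = b" using that * by (auto simp: sep_def)
    qed
    moreover have "h ` E \<subseteq> P" using P(2) E by auto
    ultimately show ?thesis using P(1) by (meson card_inj_on_le inj_on_finite)
  qed
  have "sep {}" by (simp add: sep_def)
  then obtain E where E: "sep E" "\<And>E'. sep E' \<Longrightarrow> card E' \<le> card E"
    using ex_has_greatest_nat[of sep "{}" card "Suc (card P)"] bound by (auto simp: less_Suc_eq_le)
  show thesis
  proof (rule that[of E])
    fix a assume a: "a \<in> D"
    show "\<exists>b\<in>E. \<forall>t. 0 \<le> t \<longrightarrow> t < int n \<longrightarrow> dist (orb t a) (orb t b) \<le> e"
    proof (rule ccontr)
      assume "\<not> ?thesis"
      then have far: "\<not> close a b" if "b \<in> E" for b using that by (auto simp: close_def)
      have sym: "close c b" if "close b c" for b c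
        using that by (simp add: close_def dist_commute)
      have "a \<notin> E" using far[of a] assms(2) by (auto simp: close_def)
      moreover have "b = c" if "b \<in> insert a E" "c \<in> insert a E" "close b c" for b c
        using that far sym E(1) by (auto simp: sep_def)
      then have "sep (insert a E)" using E(1) a by (simp add: sep_def)
      ultimately have "card (insert a E) \<le> card E" "finite E" using E(2)[of "insert a E"] E(1) bound[of E] by simp_all
      then show False using \<open>a \<notin> E\<close> by simp
    qed
  next
    fix a b assume "a \<in> E" "b \<in> E"
      "\<And>t. 0 \<le> t \<Longrightarrow> t < int n \<Longrightarrow> dist (orb t a) (orb t b) \<le> e"
    then show "a = b" using E(1) unfolding sep_def close_def by blast
  next
    show "finite E" using E(1) bound by blast
    show "E \<subseteq> D" using E(1) by (simp add: sep_def)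
  qed
qed

end

section \<open>Shadowing and expansivity\<close>

locale nonwandering_smale = compact_homeo +
  fixes \<eta> :: real
  assumes eta_pos: "\<eta> > 0"
    and expansive: "\<lbrakk>x \<in> X; y \<in> X; \<And>n. dist (orb n x) (orb n y) \<le> \<eta>\<rbrakk> \<Longrightarrow> x = y"
    and tracing: "pseudo_orbit_tracing_property X f"
    and non_wandering: "non_wandering X f"
begin

lemma shadowing:
  assumes "e > 0"
  obtains d where "d > 0"
    "\<And>u. \<lbrakk>\<And>n. u n \<in> X; \<And>n. dist (u (n + 1)) (f (u n)) \<le> d\<rbrakk>
        \<Longrightarrow> \<exists>z\<in>X. \<forall>n. dist (u n) (orb n z) \<le> e"
proof -
  obtain d where "d > 0" "\<forall>u. pseudo_orbit X f d u \<longrightarrow> (\<exists>z\<in>X. traced_by X f e u z)"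
    using tracing assms unfolding pseudo_orbit_tracing_property_def by blast
  then show thesis
    using that[of d] unfolding pseudo_orbit_def traced_by_def by simp
qed

text \<open>By compactness: a limit of counterexamples for growing \<open>r\<close> would be a pair
  of distinct points whose entire orbits stay within \<open>\<eta>\<close>.\<close>

lemma uniform_expansivity:
  assumes "e > 0"
  obtains r :: nat where
    "\<And>x y. \<lbrakk>x \<in> X; y \<in> X; \<And>j. \<bar>j\<bar> \<le> int r \<Longrightarrow> dist (orb j x) (orb j y) \<le> \<eta>\<rbrakk> \<Longrightarrow> dist x y \<le> e"
proof (rule ccontr)
  assume "\<not> thesis"
  then have "\<forall>r. \<exists>x y. x \<in> X \<and> y \<in> X \<and> (\<forall>j. \<bar>j\<bar> \<le> int r \<longrightarrow> dist (orb j x) (orb j y) \<le> \<eta>) \<and> dist x y > e"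
    using that not_le by meson
  then obtain a b where ab: "\<And>r. a r \<in> X" "\<And>r. b r \<in> X" "\<And>r. dist (a r) (b r) > e"
    "\<And>r j. \<bar>j\<bar> \<le> int r \<Longrightarrow> dist (orb j (a r)) (orb j (b r)) \<le> \<eta>"
    by metis
  have "compact (X \<times> X)"
    using compact_X compact_Times by blast
  then have seq: "seq_compact (X \<times> X)" by (rule compact_imp_seq_compact)
  obtain l k where l: "l \<in> X \<times> X" and k: "strict_mono k"
    "((\<lambda>n. (a n, b n)) \<circ> k) \<longlonglongrightarrow> l"
    by (rule seq_compactE[OF seq, of "\<lambda>n. (a n, b n)"]) (use ab in auto)
  define x y where "x = fst l" and "y = snd l"
  have xy: "x \<in> X" "y \<in> X" using l by (auto simp: x_def y_def)
  have lim: "(\<lambda>n. a (k n)) \<longlonglongrightarrow> x" "(\<lambda>n. b (k n)) \<longlonglongrightarrow> y"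
    using tendsto_fst[OF k(2)] tendsto_snd[OF k(2)] by (simp_all add: x_def y_def o_def)
  have "dist (orb j x) (orb j y) \<le> \<eta>" for j
  proof -
    have "(\<lambda>n. dist (orb j (a (k n))) (orb j (b (k n)))) \<longlonglongrightarrow> dist (orb j x) (orb j y)"
      using lim xy ab
      by (intro tendsto_dist continuous_on_tendsto_compose[OF continuous_orb]) auto
    moreover have "\<forall>\<^sub>F n in sequentially. dist (orb j (a (k n))) (orb j (b (k n))) \<le> \<eta>"
    proof (rule eventually_sequentiallyI[of "nat \<bar>j\<bar>"])
      fix n assume "nat \<bar>j\<bar> \<le> n"
      then have "\<bar>j\<bar> \<le> int (k n)" using seq_suble[OF k(1), of n] by linarith
      then show "dist (orb j (a (k n))) (orb j (b (k n))) \<le> \<eta>" using ab(4) by blast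
    qed
    ultimately show ?thesis by (rule tendsto_upperbound) simp
  qed
  then have "x = y" using expansive xy by blast
  have "(\<lambda>n. dist (a (k n)) (b (k n))) \<longlonglongrightarrow> dist x y" by (intro tendsto_dist lim)
  then have "e \<le> dist x y"
    by (rule tendsto_lowerbound) (use ab(3) in \<open>auto intro: less_imp_le always_eventually\<close>)
  then show False using \<open>x = y\<close> assms by simp
qed

text \<open>The past of \<open>x\<close> is glued to the future of \<open>y\<close> with one jump
  and shadowed within \<open>\<eta>\<close>. Uniform expansivity upgrades staying
  \<open>\<eta>\<close>-close on a half-line of times to convergence.\<close>

lemma heteroclinic_point:
  obtains \<rho> where "\<rho> > 0"
    "\<And>x y. \<lbrakk>x \<in> X; y \<in> X; dist x y \<le> \<rho>\<rbrakk> \<Longrightarrow> \<exists>z\<in>X. \<forall>e>0. \<exists>r::nat. \<forall>n\<ge>r.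
        dist (orb (- int n) x) (orb (- int n) z) \<le> e \<and> dist (orb (int n) y) (orb (int n) z) \<le> e"
proof -
  obtain \<rho> where \<rho>: "\<rho> > 0"
    "\<And>u. \<lbrakk>\<And>n. u n \<in> X; \<And>n. dist (u (n + 1)) (f (u n)) \<le> \<rho>\<rbrakk>
        \<Longrightarrow> \<exists>z\<in>X. \<forall>n. dist (u n) (orb n z) \<le> \<eta>"
    using shadowing[OF eta_pos] by metis
  have "\<exists>z\<in>X. \<forall>e>0. \<exists>r::nat. \<forall>n\<ge>r.
      dist (orb (- int n) x) (orb (- int n) z) \<le> e \<and> dist (orb (int n) y) (orb (int n) z) \<le> e"
    if xy: "x \<in> X" "y \<in> X" "dist x y \<le> \<rho>" for x y
  proof -
    define u where "u n = (if n < 0 then orb n x else orb n y)" for n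
    have uX: "u n \<in> X" for n using xy orb_in by (simp add: u_def)
    have "dist (u (n + 1)) (f (u n)) \<le> \<rho>" for n
    proof (cases "n = -1")
      case True
      then show ?thesis
        using xy orb_Suc[OF xy(1), of "-1"] by (simp add: u_def orb_0 dist_commute)
    next
      case False
      then show ?thesis using xy \<rho>(1) orb_Suc by (simp add: u_def)
    qed
    then obtain z where z: "z \<in> X" "\<And>n. dist (u n) (orb n z) \<le> \<eta>"
      using \<rho>(2) uX by blast
    have "\<exists>r::nat. \<forall>n\<ge>r.
      dist (orb (- int n) x) (orb (- int n) z) \<le> e \<and> dist (orb (int n) y) (orb (int n) z) \<le> e"
      if e: "e > 0" for e
    proof -
      obtain r :: nat where r: "\<And>x y. \<lbrakk>x \<in> X; y \<in> X;
          \<And>j. \<bar>j\<bar> \<le> int r \<Longrightarrow> dist (orb j x) (orb j y) \<le> \<eta>\<rbrakk> \<Longrightarrow> dist x y \<le> e"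
        using uniform_expansivity[OF e] by metis
      \<comment> \<open>One more than \<open>r\<close>, so that all times within \<open>r\<close> of
        \<open>- int n\<close> are negative, where \<open>u\<close> still follows
        \<open>x\<close>.\<close>
      show ?thesis
      proof (intro exI[of _ "r + 1"] allI impI conjI)
        fix n assume n: "r + 1 \<le> n"
        show "dist (orb (- int n) x) (orb (- int n) z) \<le> e"
        proof (rule r)
          fix j assume "\<bar>j\<bar> \<le> int r"
          then have "j - int n < 0" using n by linarith
          then show "dist (orb j (orb (- int n) x)) (orb j (orb (- int n) z)) \<le> \<eta>"
            using z(2)[of "j - int n"] z(1) xy orb_add[of x j "- int n"] orb_add[of z j "- int n"]
            by (simp add: u_def)
        qed (use xy z orb_in in auto)
        show "dist (orb (int n) y) (orb (int n) z) \<le> e"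
        proof (rule r)
          fix j assume "\<bar>j\<bar> \<le> int r"
          then have "\<not> j + int n < 0" using n by linarith
          then show "dist (orb j (orb (int n) y)) (orb j (orb (int n) z)) \<le> \<eta>"
            using z(2)[of "j + int n"] z(1) xy orb_add[of y j "int n"] orb_add[of z j "int n"]
            by (simp add: u_def)
        qed (use xy z orb_in in auto)
      qed
    qed
    then show ?thesis using z(1) by blast
  qed
  then show thesis using that \<rho>(1) by blast
qed

section \<open>Chain recurrence\<close>

text \<open>Finite pseudo-orbits become relational powers, so that concatenation adds exponents and
  lengths can be tracked modulo \<open>s\<close>.\<close>

definition step :: "real \<Rightarrow> 'a \<Rightarrow> 'a \<Rightarrow> bool" where
  "step d a b \<longleftrightarrow> a \<in> X \<and> b \<in> X \<and> dist b (f a) \<le> d"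

lemma step_mono: "step d a b \<Longrightarrow> d \<le> d' \<Longrightarrow> step d' a b"
  by (auto simp: step_def)

lemma chain_mono: "(step d ^^ n) a b \<Longrightarrow> d \<le> d' \<Longrightarrow> (step d' ^^ n) a b"
  by (induction n arbitrary: b) (auto intro: step_mono)

lemma chain_trans: "(step d ^^ m) a b \<Longrightarrow> (step d ^^ n) b c \<Longrightarrow> (step d ^^ (m + n)) a c"
  by (auto simp: relpowp_add)

lemma chain_loop: "(step d ^^ n) a a \<Longrightarrow> (step d ^^ (k * n)) a a"
  by (induction k) (auto intro: chain_trans)

lemma orb_chain: "a \<in> X \<Longrightarrow> d \<ge> 0 \<Longrightarrow> (step d ^^ n) a (orb (int n) a)"
proof (induction n)
  case (Suc n)
  have "step d (orb (int n) a) (orb (int (Suc n)) a)"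
    using Suc.prems orb_Suc[of a "int n"] orb_in[of a] f_in[OF orb_in[of a "int n"]]
    by (simp add: step_def add.commute)
  then show ?case using Suc by auto
qed (simp add: orb_0)

text \<open>An orbit segment that returns to a small neighbourhood of \<open>a\<close> becomes a
  closed chain once both of its end points are replaced by \<open>a\<close>.\<close>

lemma chain_recurrent:
  assumes "a \<in> X" "d > 0"
  obtains n where "n > 0" "(step d ^^ n) a a"
proof -
  obtain e where e: "e > 0" "\<And>x y. \<lbrakk>x \<in> X; y \<in> X; dist x y \<le> e\<rbrakk> \<Longrightarrow> dist (f x) (f y) \<le> d / 2"
    using uniform_modulus[OF continuous_f, of "d / 2"] assms(2) by auto
  define U where "U = X \<inter> ball a (min e (d / 2))"
  have "openin (top_of_set X) U"
    by (simp add: U_def openin_open_Int)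
  then have "nbhd_in X a U"
    unfolding nbhd_in_def U_def using assms e(1) by auto
  then obtain n where n: "n \<ge> 1" "U \<inter> (f ^^ n) ` U \<noteq> {}"
    using non_wandering assms(1) unfolding non_wandering_def non_wandering_point_def by blast
  then obtain p where p: "p \<in> U" "(f ^^ n) p \<in> U" by blast
  define u where "u i = (if i = 0 \<or> i = n then a else (f ^^ i) p)" for i :: nat
  have "step d (u i) (u (Suc i))" if "i < n" for i
  proof -
    have near: "(f ^^ i) p \<in> X" "u i \<in> X" "dist (u i) ((f ^^ i) p) \<le> e"
      and near': "u (Suc i) \<in> X" "dist (u (Suc i)) ((f ^^ Suc i) p) \<le> d / 2"
      using p that n assms e(1) funpow_in[of f p] f_in
      unfolding u_def U_def by (auto simp del: funpow.simps)
    have "dist (f ((f ^^ i) p)) (f (u i)) \<le> d / 2"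
      using e(2) near by (metis dist_commute)
    then have "dist (u (Suc i)) (f (u i)) \<le> d"
      using near'(2) dist_triangle[of "u (Suc i)" "f (u i)" "(f ^^ Suc i) p"] by simp
    then show ?thesis using near near' by (simp add: step_def)
  qed
  then have "(step d ^^ n) a a"
    unfolding relpowp_fun_conv by (intro exI[of _ u]) (simp add: u_def)
  then show thesis using that[of n] n by simp
qed

text \<open>A loop at \<open>a\<close> of length divisible by \<open>s\<close> undoes the step: its
  point \<open>u1\<close> after one step is close to \<open>b\<close>, so \<open>b\<close> can jump
  straight to the next point \<open>u2\<close> and follow the loop home. This takes one step less
  than the loop, hence \<open>Suc n\<close>.\<close>

lemma step_reverse:
  assumes "d > 0" "s > 0"
  obtains e where "e > 0" "\<And>a b. step e a b \<Longrightarrow> \<exists>n. s dvd Suc n \<and> (step d ^^ n) b a"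
proof -
  obtain c where c: "c > 0" "\<And>x y. \<lbrakk>x \<in> X; y \<in> X; dist x y \<le> c\<rbrakk> \<Longrightarrow> dist (f x) (f y) \<le> d / 2"
    using uniform_modulus[OF continuous_f, of "d / 2"] assms(1) by auto
  define e where "e = min (c / 2) (d / 2)"
  have "\<exists>n. s dvd Suc n \<and> (step d ^^ n) b a" if ab: "step e a b" for a b
  proof -
    have X: "a \<in> X" "b \<in> X" using ab by (auto simp: step_def)
    obtain n where n: "n > 0" "(step e ^^ n) a a"
      using chain_recurrent[of a e] X c(1) assms(1) by (auto simp: e_def)
    \<comment> \<open>The factor 2 makes the loop at least two steps long, so that \<open>u1\<close>
      and \<open>u2\<close> both exist.\<close>
    have "2 * s * n \<noteq> 0" "2 * s * n \<noteq> 1" using n assms by auto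
    then have "\<exists>k. 2 * s * n = Suc (Suc k)" by presburger
    then obtain k where k: "2 * s * n = Suc (Suc k)" by blast
    have "(step e ^^ Suc (Suc k)) a a" using chain_loop[OF n(2), of "2 * s"] k by simp
    then obtain u1 where u1: "step e a u1" "(step e ^^ Suc k) u1 a"
      using relpowp_Suc_D2 by fast
    obtain u2 where "step e u1 u2" "(step e ^^ k) u2 a"
      using relpowp_Suc_D2[OF u1(2)] by blast
    note u = u1(1) this
    have "dist u1 b \<le> c"
      using u(1) ab dist_triangle2[of u1 b "f a"] by (auto simp: step_def e_def)
    then have "dist (f u1) (f b) \<le> d / 2" using c(2) u X by (auto simp: step_def)
    moreover have "dist u2 (f u1) \<le> d / 2" using u(2) by (simp add: step_def e_def)
    ultimately have "dist u2 (f b) \<le> d"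
      using dist_triangle[of u2 "f b" "f u1"] by simp
    then have "step d b u2" using u(2) X by (simp add: step_def)
    moreover have "(step d ^^ k) u2 a"
      using chain_mono[OF u(3), of d] assms(1) by (simp add: e_def)
    ultimately have "(step d ^^ Suc k) b a" by (metis relpowp_Suc_I2)
    moreover have "s dvd Suc (Suc k)" using k by (metis dvd_triv_left dvd_mult2 dvd_triv_right)
    ultimately show ?thesis by blast
  qed
  moreover have "e > 0" using c assms by (simp add: e_def)
  ultimately show thesis using that by blast
qed

lemma chain_reverse:
  assumes "\<And>a b. step e a b \<Longrightarrow> \<exists>n. s dvd Suc n \<and> (step d ^^ n) b a" "(step e ^^ k) a b"
  shows "\<exists>n. s dvd n + k \<and> (step d ^^ n) b a"
  using assms(2)
proof (induction k arbitrary: b)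
  case 0
  then show ?case by (intro exI[of _ 0]) auto
next
  case (Suc k)
  then obtain c where c: "(step e ^^ k) a c" "step e c b" by auto
  then obtain n m where "s dvd n + k" "(step d ^^ n) c a" "s dvd Suc m" "(step d ^^ m) b c"
    using Suc.IH assms(1) by meson
  then have "s dvd (n + k) + Suc m" "(step d ^^ (m + n)) b a"
    by (auto intro: chain_trans simp only: dvd_add)
  then show ?case by (intro exI[of _ "m + n"]) (simp add: ac_simps)
qed

section \<open>Chain equivalence along lengths divisible by \<open>s\<close>\<close>

definition eqv :: "nat \<Rightarrow> 'a \<Rightarrow> 'a \<Rightarrow> bool" where
  "eqv s a b \<longleftrightarrow> a \<in> X \<and> b \<in> X \<and> (\<forall>d>0. \<exists>n. s dvd n \<and> (step d ^^ n) a b)"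

lemma eqv_trans: "eqv s a b \<Longrightarrow> eqv s b c \<Longrightarrow> eqv s a c"
  unfolding eqv_def by (meson chain_trans dvd_add)

lemma eqv_sym:
  assumes "eqv s a b" "s > 0"
  shows "eqv s b a"
  unfolding eqv_def
proof (intro conjI allI impI)
  fix d :: real assume "d > 0"
  then obtain e where e: "e > 0" "\<And>a b. step e a b \<Longrightarrow> \<exists>n. s dvd Suc n \<and> (step d ^^ n) b a"
    using step_reverse[OF _ assms(2)] by metis
  obtain k where k: "s dvd k" "(step e ^^ k) a b" using assms(1) e(1) by (auto simp: eqv_def)
  then obtain n where "s dvd n + k" "(step d ^^ n) b a"
    using chain_reverse[OF e(2) k(2)] by blast
  then show "\<exists>n. s dvd n \<and> (step d ^^ n) b a"
    using k(1) dvd_add_left_iff by blast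
qed (use assms in \<open>auto simp: eqv_def\<close>)

text \<open>Forward orbit segments are exact chains. For negative \<open>k\<close> such a segment
  leads from the earlier point to \<open>a\<close>, and symmetry reverses it.\<close>

lemma eqv_orb:
  assumes "a \<in> X" "s > 0"
  shows "eqv s a (orb (int s * k) a)"
proof -
  have *: "eqv s b (orb (int (s * n)) b)" if "b \<in> X" for b n
    unfolding eqv_def using that orb_in orb_chain[OF that] by (meson dvd_triv_left less_imp_le)
  show ?thesis
  proof (cases "k \<ge> 0")
    case True
    then show ?thesis using *[OF assms(1), of "nat k"] by simp
  next
    case False
    let ?b = "orb (int s * k) a"
    have "int (s * nat (- k)) = - (int s * k)" using False by simp
    then have "orb (int (s * nat (- k))) ?b = a"
      using orb_add[OF assms(1), of "int (s * nat (- k))" "int s * k"] by (simp add: orb_0)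
    then have "eqv s ?b a" using *[of ?b "nat (- k)"] assms orb_in by metis
    then show ?thesis using eqv_sym assms(2) by blast
  qed
qed

text \<open>The radius \<open>\<rho>\<close> does not depend on \<open>s\<close>: later \<open>s\<close> is the period of a point chosen
  within distance \<open>\<rho>\<close> of a given one.\<close>

lemma eqv_near:
  obtains \<rho> where "\<rho> > 0" "\<And>s a b. \<lbrakk>s > 0; a \<in> X; b \<in> X; dist a b \<le> \<rho>\<rbrakk> \<Longrightarrow> eqv s a b"
proof -
  obtain \<rho> where \<rho>: "\<rho> > 0"
    "\<And>x y. \<lbrakk>x \<in> X; y \<in> X; dist x y \<le> \<rho>\<rbrakk> \<Longrightarrow> \<exists>z\<in>X. \<forall>e>0. \<exists>r::nat. \<forall>n\<ge>r.
        dist (orb (- int n) x) (orb (- int n) z) \<le> e \<and> dist (orb (int n) y) (orb (int n) z) \<le> e"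
    using heteroclinic_point by metis
  have "eqv s a b" if s: "s > 0" and ab: "a \<in> X" "b \<in> X" "dist a b \<le> \<rho>" for s a b
  proof -
    obtain z where z: "z \<in> X" "\<And>e. e > 0 \<Longrightarrow> \<exists>r::nat. \<forall>n\<ge>r.
        dist (orb (- int n) a) (orb (- int n) z) \<le> e \<and> dist (orb (int n) b) (orb (int n) z) \<le> e"
      using \<rho>(2) ab by blast
    have "\<exists>n. s dvd n \<and> (step d ^^ n) a b" if d: "d > 0" for d
    proof -
      obtain r :: nat where r: "\<And>n. n \<ge> r \<Longrightarrow>
        dist (orb (- int n) a) (orb (- int n) z) \<le> d \<and> dist (orb (int n) b) (orb (int n) z) \<le> d"
        using z(2)[OF d] by blast
      \<comment> \<open>A multiple of \<open>s\<close> larger than \<open>r\<close>, so that both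
        \<open>n\<close> and its predecessor \<open>m\<close> lie in the range where
        \<open>z\<close> is close to the two orbits.\<close>
      define n where "n = s * (r + 1)"
      have n: "n \<ge> r + 1" using mult_le_mono1[of 1 s "r + 1"] s by (simp only: n_def) simp
      then obtain m where m: "n = Suc m" "m \<ge> r" by (metis Suc_eq_plus1 Suc_le_D Suc_le_mono)
      let ?a = "orb (- int n) a" and ?b = "orb (int n) b"
      have "- int n = int s * - int (r + 1)" "int n = int s * int (r + 1)"
        by (simp_all add: n_def algebra_simps)
      then have "eqv s a ?a" "eqv s ?b b"
        using eqv_orb[OF ab(1) s, of "- int (r + 1)"] eqv_orb[OF ab(2) s, of "int (r + 1)"]
          eqv_sym[OF _ s] by auto
      then obtain k l where k: "s dvd k" "(step d ^^ k) a ?a" and l: "s dvd l" "(step d ^^ l) ?b b"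
        using d unfolding eqv_def by blast
      have "f ?a = orb (- int m) a" using orb_Suc[OF ab(1), of "- int n"] m by simp
      then have 1: "step d ?a (orb (- int m) z)"
        using r[of m] m orb_in[OF ab(1)] orb_in[OF z(1)] by (simp add: step_def dist_commute)
      have 2: "(step d ^^ (2 * m)) (orb (- int m) z) (orb (int m) z)"
        using orb_chain[of "orb (- int m) z" d "2 * m"] d z(1) orb_in
          orb_add[OF z(1), of "2 * int m" "- int m"] by simp
      have "f (orb (int m) z) = orb (int n) z"
        using orb_Suc[OF z(1), of "int m"] m by (simp add: add.commute)
      then have 3: "step d (orb (int m) z) ?b"
        using r[of n] n orb_in[OF ab(2)] orb_in[OF z(1)] by (simp add: step_def)
      \<comment> \<open>The route goes from \<open>a\<close> to its own past, jumps to the orbit of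
        \<open>z\<close>, follows it for \<open>2 * m\<close> steps, jumps to the future of
        \<open>b\<close> and returns to \<open>b\<close>. Counting the two jumps, the middle part
        has length \<open>2 * n\<close>, a multiple of \<open>s\<close>.\<close>
      have "(step d ^^ (k + (Suc 0 + (2 * m + (Suc 0 + l))))) a b"
        using k l 1 2 3 by (intro chain_trans) (auto simp: relpowp_1[simplified])
      moreover have "k + (Suc 0 + (2 * m + (Suc 0 + l))) = k + 2 * n + l" using m by simp
      moreover have "s dvd k + 2 * n + l" using k l by (simp add: n_def)
      ultimately show ?thesis by metis
    qed
    then show ?thesis using ab by (simp add: eqv_def)
  qed
  then show thesis using that \<rho>(1) by blast
qed

lemma eqv_endomorphism:
  assumes "endomorphism X f \<tau>" "eqv s a b"
  shows "eqv s (\<tau> a) (\<tau> b)"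
  unfolding eqv_def
proof (intro conjI allI impI)
  fix d :: real assume "d > 0"
  then obtain e where e: "e > 0" "\<And>x y. \<lbrakk>x \<in> X; y \<in> X; dist x y \<le> e\<rbrakk> \<Longrightarrow> dist (\<tau> x) (\<tau> y) \<le> d"
    using uniform_modulus[of \<tau> d] assms(1) by (auto simp: endomorphism_def)
  have "step d (\<tau> x) (\<tau> y)" if "step e x y" for x y
  proof -
    have "\<tau> (f x) = f (\<tau> x)" "\<tau> x \<in> X" "\<tau> y \<in> X"
      using that assms(1) by (auto simp: step_def endomorphism_def)
    then show ?thesis using that e(2)[of y "f x"] f_in by (auto simp: step_def)
  qed
  then have "(step e ^^ n) a x \<Longrightarrow> (step d ^^ n) (\<tau> a) (\<tau> x)" for n x
    by (induction n arbitrary: x) auto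
  then show "\<exists>n. s dvd n \<and> (step d ^^ n) (\<tau> a) (\<tau> b)"
    using assms(2) e(1) unfolding eqv_def by blast
qed (use assms in \<open>auto simp: eqv_def endomorphism_def\<close>)

section \<open>Periodic points and surjunctivity\<close>

text \<open>A closed chain through \<open>x\<close> is repeated forever and shadowed. The shadowing
  point and its image after \<open>s\<close> steps follow the same periodic sequence within
  \<open>\<eta> / 2\<close>, so expansivity identifies them.\<close>

lemma periodic_dense:
  assumes "x \<in> X" "e > 0"
  obtains p s where "p \<in> X" "s > 0" "orb (int s) p = p" "dist x p \<le> e"
proof -
  obtain d where d: "d > 0"
    "\<And>u. \<lbrakk>\<And>n. u n \<in> X; \<And>n. dist (u (n + 1)) (f (u n)) \<le> d\<rbrakk>
        \<Longrightarrow> \<exists>z\<in>X. \<forall>n. dist (u n) (orb n z) \<le> min e (\<eta> / 2)"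
    by (rule shadowing[of "min e (\<eta> / 2)"]) (use assms(2) eta_pos in simp, blast)
  obtain s where s: "s > 0" "(step d ^^ s) x x" using chain_recurrent[OF assms(1) d(1)] by blast
  then obtain c where c: "c 0 = x" "c s = x" "\<And>i. i < s \<Longrightarrow> step d (c i) (c (Suc i))"
    by (auto simp: relpowp_fun_conv)
  define u where "u n = c (nat (n mod int s))" for n
  have u: "step d (u n) (u (n + 1))" for n
  proof -
    let ?i = "nat (n mod int s)"
    have i: "?i < s" using s(1) by (simp add: nat_less_iff)
    have int_i: "int ?i = n mod int s" using s(1) by simp
    have m: "(n + 1) mod int s = int (Suc ?i) mod int s"
      using int_i by (simp add: mod_add_right_eq add.commute)
    have "u (n + 1) = c (Suc ?i)"
    proof (cases "Suc ?i = s")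
      case True
      then have "u (n + 1) = c 0" using m by (simp add: u_def)
      then show ?thesis using True c by simp
    next
      case False
      then have "int (Suc ?i) < int s" using i by linarith
      then have "(n + 1) mod int s = int (Suc ?i)" using m by simp
      then show ?thesis by (simp only: u_def nat_int)
    qed
    then show ?thesis using c(3)[OF i] by (simp add: u_def)
  qed
  then obtain p where p: "p \<in> X" "\<And>n. dist (u n) (orb n p) \<le> min e (\<eta> / 2)"
    using d(2)[of u] by (auto simp: step_def)
  have "orb (int s) p = p"
  proof (rule expansive)
    fix n
    have "u (n + int s) = u n" by (simp add: u_def)
    then have "dist (u n) (orb (n + int s) p) \<le> \<eta> / 2" using p(2)[of "n + int s"] by simp
    then show "dist (orb n (orb (int s) p)) (orb n p) \<le> \<eta>"
      using p(2)[of n] orb_add[OF p(1), of n "int s"]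
        dist_triangle3[of "orb (n + int s) p" "orb n p" "u n"] by simp
  qed (use p orb_in in auto)
  moreover have "dist x p \<le> e" using p(2)[of 0] c by (simp add: u_def orb_0)
  ultimately show thesis using that p s by blast
qed

lemma orb_periodic:
  assumes "p \<in> X" "orb (int s) p = p"
  shows "orb (int s * k) p = p"
proof (induction k rule: int_induct[where k = 0])
  case base
  show ?case by (simp add: orb_0)
next
  case (step1 i)
  then show ?case using assms orb_add[OF assms(1), of "int s * i" "int s"]
    by (simp add: distrib_left)
next
  case (step2 i)
  then show ?case using assms orb_add[OF assms(1), of "int s * (i - 1)" "int s"]
    by (simp add: right_diff_distrib)
qed

text \<open>If two points of period \<open>s\<close> have equal codes, their orbits stay within
  \<open>\<eta>\<close> over one period, hence forever, and the points coincide.\<close>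

lemma finite_periodic:
  assumes "s > 0"
  shows "finite {p \<in> X. orb (int s) p = p}"
proof -
  obtain P :: "'a set" and h where P: "finite P" "\<And>x. x \<in> X \<Longrightarrow> h x \<in> P"
    "\<And>x y j. \<lbrakk>x \<in> X; y \<in> X; h x = h y; \<bar>j\<bar> \<le> int s\<rbrakk> \<Longrightarrow> dist (orb j x) (orb j y) \<le> \<eta>"
    by (rule orbit_coding[OF eta_pos, of s]) blast
  have red: "orb j p = orb (j mod int s) p" if "p \<in> X" "orb (int s) p = p" for j p
    using orb_add[OF that(1), of "j mod int s" "int s * (j div int s)"] orb_periodic[OF that]
    by simp
  have "inj_on h {p \<in> X. orb (int s) p = p}"
  proof (rule inj_onI)
    fix p q assume pq: "p \<in> {p \<in> X. orb (int s) p = p}" "q \<in> {p \<in> X. orb (int s) p = p}" "h p = h q"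
    have "dist (orb j p) (orb j q) \<le> \<eta>" for j
    proof -
      have "\<bar>j mod int s\<bar> \<le> int s" using assms by (simp add: less_imp_le)
      then have "dist (orb (j mod int s) p) (orb (j mod int s) q) \<le> \<eta>"
        using P(3) pq by blast
      then show ?thesis using pq red[of p j] red[of q j] by simp
    qed
    then show "p = q" using expansive pq by blast
  qed
  moreover have "h ` {p \<in> X. orb (int s) p = p} \<subseteq> P" using P(2) by blast
  ultimately show ?thesis using P(1) by (rule inj_on_finite)
qed

lemma surjunctive: "surjunctive X f"
  unfolding surjunctive_def
proof (intro allI impI)
  fix \<tau> assume \<tau>: "endomorphism X f \<tau>" "inj_on \<tau> X"
  have X: "\<tau> ` X \<subseteq> X" and cont: "continuous_on X \<tau>" using \<tau>(1) by (auto simp: endomorphism_def)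
  have per: "p \<in> \<tau> ` X" if p: "p \<in> X" "s > 0" "orb (int s) p = p" for p s
  proof -
    let ?P = "{p \<in> X. orb (int s) p = p}"
    have "\<tau> ` ?P \<subseteq> ?P" using X orb_commute[OF \<tau>(1), of _ "int s"] by force
    moreover have "inj_on \<tau> ?P" using \<tau>(2) by (rule inj_on_subset) auto
    ultimately have "\<tau> ` ?P = ?P" using finite_periodic[OF p(2)] endo_inj_surj by blast
    then show ?thesis using p by blast
  qed
  \<comment> \<open>Periodic points are dense and lie in the image; since the image is compact, its
    closure adds nothing.\<close>
  have "x \<in> closure (\<tau> ` X)" if x: "x \<in> X" for x
    unfolding closure_approachable
  proof (intro allI impI)
    fix e :: real assume "e > 0"
    then have "e / 2 > 0" by simp
    obtain p s where "p \<in> X" "s > 0" "orb (int s) p = p" "dist x p \<le> e / 2"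
      by (rule periodic_dense[OF x \<open>e / 2 > 0\<close>]) blast
    then show "\<exists>y\<in>\<tau> ` X. dist y x < e"
      using per \<open>e > 0\<close> by (intro bexI[of _ p]) (auto simp: dist_commute)
  qed
  moreover have "closed (\<tau> ` X)"
    using compact_continuous_image[OF cont compact_X] compact_imp_closed by blast
  ultimately show "\<tau> ` X = X" using X by auto
qed

section \<open>Excursions\<close>

text \<open>Preimages of unions of classes are again unions of classes, and there are only finitely
  many such unions. The iterated preimages of the class of \<open>q\<close> therefore repeat, and
  surjectivity lets images cancel preimages.\<close>

lemma power_fixes_class:
  assumes \<tau>: "endomorphism X f \<tau>" and surj: "\<tau> ` X = X" and s: "s > 0"
  obtains k where "k > 0" "(\<tau> ^^ k) ` {a. eqv s q a} = {a. eqv s q a}"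
proof -
  let ?D = "{a. eqv s q a}"
  define S where "S = {A. A \<subseteq> X \<and> (\<forall>a b. a \<in> A \<longrightarrow> eqv s a b \<longrightarrow> b \<in> A)}"
  define pre where "pre A = {a \<in> X. \<tau> a \<in> A}" for A
  obtain \<rho> where \<rho>: "\<rho> > 0" "\<And>a b. \<lbrakk>a \<in> X; b \<in> X; dist a b \<le> \<rho>\<rbrakk> \<Longrightarrow> eqv s a b"
    using eqv_near s by metis
  obtain K where K: "finite K" "K \<subseteq> X" "\<And>a. a \<in> X \<Longrightarrow> \<exists>c\<in>K. dist a c \<le> \<rho>"
    by (rule finite_net[OF subset_refl \<rho>(1)]) blast
  \<comment> \<open>Every point is equivalent to some net point, so a union of classes is determined
    by its trace on \<open>K\<close>.\<close>
  have sub: "A \<subseteq> B" if "A \<in> S" "B \<in> S" "A \<inter> K = B \<inter> K" for A B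
  proof
    fix a assume a: "a \<in> A"
    then have "a \<in> X" using that(1) by (auto simp: S_def)
    then obtain c where c: "c \<in> K" "eqv s a c" using K \<rho>(2) by blast
    then have "c \<in> B" using that a unfolding S_def by blast
    then show "a \<in> B" using eqv_sym[OF c(2) s] that(2) unfolding S_def by blast
  qed
  have "inj_on (\<lambda>A. A \<inter> K) S"
    by (rule inj_onI) (metis sub subset_antisym)
  then have fin: "finite S"
    by (rule inj_on_finite[of _ _ "Pow K"]) (use K(1) in auto)
  have pre_S: "pre A \<in> S" if "A \<in> S" for A
    using that eqv_endomorphism[OF \<tau>, of s] unfolding S_def pre_def by (auto simp: eqv_def)
  have pow_S: "(pre ^^ i) ?D \<in> S" for i
  proof (induction i)
    case 0
    show ?case using eqv_trans by (auto simp: S_def eqv_def)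
  next
    case (Suc i)
    then show ?case using pre_S by simp
  qed
  have "\<not> inj (\<lambda>i. (pre ^^ i) ?D)"
  proof
    assume "inj (\<lambda>i. (pre ^^ i) ?D)"
    then have "infinite (range (\<lambda>i. (pre ^^ i) ?D))" using finite_imageD by blast
    moreover have "range (\<lambda>i. (pre ^^ i) ?D) \<subseteq> S" using pow_S by blast
    ultimately show False using fin finite_subset by blast
  qed
  then obtain i0 j0 where "(pre ^^ i0) ?D = (pre ^^ j0) ?D" "i0 \<noteq> j0"
    unfolding inj_def by blast
  then obtain i j where ij: "(pre ^^ i) ?D = (pre ^^ j) ?D" "i < j"
    by (cases "i0 < j0") (auto simp: not_less le_less)
  have img: "(\<tau> ^^ i) ` (pre ^^ i) A = A" if "A \<in> S" for A i
    using that
  proof (induction i arbitrary: A)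
    case (Suc i)
    have "(\<tau> ^^ Suc i) ` (pre ^^ Suc i) A = \<tau> ` ((\<tau> ^^ i) ` (pre ^^ i) (pre A))"
      by (simp add: funpow_swap1 image_comp)
    also have "\<dots> = \<tau> ` pre A" using Suc pre_S by simp
    also have "\<dots> = A" using surj Suc.prems unfolding pre_def S_def by auto
    finally show ?case .
  qed simp
  define k where "k = j - i"
  \<comment> \<open>Applying \<open>\<tau> ^^ i\<close> to both sides cancels \<open>i\<close>
    preimages and leaves a preimage of the class that equals the class.\<close>
  have "(pre ^^ j) ?D = (pre ^^ i) ((pre ^^ k) ?D)"
    using ij(2) by (simp add: k_def flip: funpow_add[THEN fun_cong, unfolded o_def])
  moreover have D_S: "?D \<in> S" using pow_S[of 0] by simp
  ultimately have "(pre ^^ k) ?D = ?D"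
    using ij(1) img[OF pow_S[of k], of i] img[OF D_S, of i] by argo
  then have "(\<tau> ^^ k) ` ?D = ?D" using img[OF D_S, of k] by argo
  then show thesis using that[of k] ij(2) by (simp add: k_def)
qed

lemma endomorphism_funpow:
  assumes "endomorphism X f \<tau>"
  shows "endomorphism X f (\<tau> ^^ k)"
proof -
  have X: "\<tau> x \<in> X" if "x \<in> X" for x using assms that by (auto simp: endomorphism_def)
  have "(\<tau> ^^ k) (f x) = f ((\<tau> ^^ k) x)" if "x \<in> X" for x
    using that assms funpow_in[of \<tau> x] X by (induction k) (auto simp: endomorphism_def)
  moreover have "continuous_on X (\<tau> ^^ k)"
    using assms by (intro funpow_continuous) (auto simp: endomorphism_def)
  ultimately show ?thesis
    using funpow_in[of \<tau>] X by (auto simp: endomorphism_def)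
qed

section \<open>Chains of one common length within a class\<close>

lemma chain_perturb_start:
  assumes "(step d ^^ Suc n) a b" "a' \<in> X" "dist (f a) (f a') \<le> d"
  shows "(step (2 * d) ^^ Suc n) a' b"
proof -
  obtain c where c: "step d a c" "(step d ^^ n) c b"
    using relpowp_Suc_D2[OF assms(1)] by blast
  have "d \<ge> 0" using assms(3) zero_le_dist order_trans by blast
  then have "(step (2 * d) ^^ n) c b" using chain_mono[OF c(2)] by simp
  moreover have "step (2 * d) a' c"
    using c(1) assms dist_triangle[of c "f a'" "f a"] by (auto simp: step_def)
  ultimately show ?thesis by (rule relpowp_Suc_I2[rotated])
qed

lemma chain_perturb_end:
  assumes "(step d ^^ Suc n) a b" "b' \<in> X" "dist b b' \<le> d"
  shows "(step (2 * d) ^^ Suc n) a b'"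
proof -
  obtain c where c: "(step d ^^ n) a c" "step d c b"
    using assms(1) by auto
  have "d \<ge> 0" using assms(3) zero_le_dist order_trans by blast
  then have "(step (2 * d) ^^ n) a c" using chain_mono[OF c(1)] by simp
  moreover have "step (2 * d) c b'"
    using c(2) assms dist_triangle[of b' "f c" b] by (auto simp: step_def dist_commute)
  ultimately show ?thesis by auto
qed

text \<open>A finite net reduces the problem to finitely many chains to and from \<open>q\<close>.
  Their different lengths, all divisible by \<open>s\<close>, are equalised by running around the
  periodic orbit of \<open>q\<close>.\<close>

lemma mixing:
  assumes "d > 0" "s > 0" "q \<in> X" "orb (int s) q = q"
  obtains T where "s dvd T" "\<And>a b. \<lbrakk>eqv s q a; eqv s q b\<rbrakk> \<Longrightarrow> (step d ^^ T) a b"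
proof -
  let ?D = "{a. eqv s q a}"
  have DX: "?D \<subseteq> X" by (auto simp: eqv_def)
  obtain e where e: "e > 0" "\<And>x y. \<lbrakk>x \<in> X; y \<in> X; dist x y \<le> e\<rbrakk> \<Longrightarrow> dist (f x) (f y) \<le> d / 2"
    using uniform_modulus[OF continuous_f, of "d / 2"] assms(1) by auto
  have "min e (d / 2) > 0" using e assms by simp
  then obtain K where K: "finite K" "K \<subseteq> ?D" "\<And>a. a \<in> ?D \<Longrightarrow> \<exists>c\<in>K. dist a c \<le> min e (d / 2)"
    using finite_net[OF DX] by metis
  have loop: "(step d' ^^ (k * s)) q q" if "d' > 0" for d' k
    using orb_chain[OF assms(3), of d' s] assms that by (intro chain_loop) simp
  \<comment> \<open>The length must be positive, because moving an end point alters the first or the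
    last step of the chain. One extra turn around the orbit of \<open>q\<close> ensures
    this.\<close>
  have pos: "\<exists>n. s dvd n \<and> n > 0 \<and> (step (d / 2) ^^ n) a b" if ab: "eqv s a b" "a = q \<or> b = q" for a b
  proof -
    obtain n where n: "s dvd n" "(step (d / 2) ^^ n) a b"
      using ab(1) assms(1) unfolding eqv_def by (metis half_gt_zero)
    have "(step (d / 2) ^^ (n + s)) a b"
      using ab(2) n(2) loop[of "d / 2" 1] chain_trans assms(1)
      by (metis add.commute half_gt_zero mult_1)
    then show ?thesis using n(1) assms(2) by (intro exI[of _ "n + s"]) auto
  qed
  have "\<exists>n. s dvd n \<and> n > 0 \<and> (step (d / 2) ^^ n) c q" if "c \<in> K" for c
    using pos[of c q] eqv_sym[OF _ assms(2)] K that by blast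
  then obtain k where k: "\<And>c. c \<in> K \<Longrightarrow> s dvd k c \<and> k c > 0 \<and> (step (d / 2) ^^ k c) c q"
    by metis
  have "\<exists>n. s dvd n \<and> n > 0 \<and> (step (d / 2) ^^ n) q c" if "c \<in> K" for c
    using pos[of q c] K that by blast
  then obtain l where l: "\<And>c. c \<in> K \<Longrightarrow> s dvd l c \<and> l c > 0 \<and> (step (d / 2) ^^ l c) q c"
    by metis
  have to: "(step d ^^ sum k K) a q" if a: "a \<in> ?D" for a
  proof -
    obtain c where c: "c \<in> K" "dist a c \<le> min e (d / 2)" using K a by blast
    obtain n where n: "k c = Suc n" using k[OF c(1)] gr0_implies_Suc by blast
    have "a \<in> X" "c \<in> X" using a c(1) K DX by auto
    then have "dist (f c) (f a) \<le> d / 2" using e(2) c(2) by (simp add: dist_commute)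
    then have 1: "(step d ^^ k c) a q"
      using chain_perturb_start[of n "d / 2" c q a] k[OF c(1)] n \<open>a \<in> X\<close> by simp
    \<comment> \<open>The chain from \<open>c\<close> takes \<open>k c\<close> steps; the other
      summands are multiples of \<open>s\<close> and are spent on loops at \<open>q\<close>. The
      total is the same for every \<open>c\<close>.\<close>
    have "sum k K = k c + sum k (K - {c})" using K(1) c(1) by (rule sum.remove)
    moreover have "s dvd sum k (K - {c})" by (rule dvd_sum) (use k in auto)
    then obtain j where "sum k (K - {c}) = s * j" ..
    ultimately show ?thesis using chain_trans[OF 1 loop[OF assms(1), of j]] by (simp add: mult.commute)
  qed
  have frm: "(step d ^^ sum l K) q a" if a: "a \<in> ?D" for a
  proof -
    obtain c where c: "c \<in> K" "dist a c \<le> min e (d / 2)" using K a by blast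
    obtain n where n: "l c = Suc n" using l[OF c(1)] gr0_implies_Suc by blast
    have "a \<in> X" using a DX by auto
    moreover have "dist c a \<le> d / 2" using c(2) by (simp add: dist_commute)
    ultimately have 1: "(step d ^^ l c) q a"
      using chain_perturb_end[of n "d / 2" q c a] l[OF c(1)] n by simp
    have "sum l K = l c + sum l (K - {c})" using K(1) c(1) by (rule sum.remove)
    moreover have "s dvd sum l (K - {c})" by (rule dvd_sum) (use l in auto)
    then obtain j where "sum l (K - {c}) = s * j" ..
    ultimately show ?thesis using chain_trans[OF loop[OF assms(1), of j] 1]
      by (simp add: mult.commute add.commute)
  qed
  show thesis
  proof (rule that[of "sum k K + sum l K"])
    show "s dvd sum k K + sum l K" using k l by (intro dvd_add dvd_sum) auto
  qed (use to frm chain_trans in blast)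
qed

text \<open>Mixing supplies a chain of length \<open>T\<close> from the orbit of \<open>z\<close> to
  the start of the excursion and one from its end back to the orbit of \<open>z\<close>, and the
  result is shadowed. \<open>T\<close> is uniform in \<open>z\<close> and \<open>w\<close>, so all
  windows can have the same length.\<close>

lemma excursion_insertion:
  assumes "e > 0" "s > 0" "q \<in> X" "orb (int s) q = q" "eqv s q x" "s dvd m"
  obtains T where "s dvd T" "\<And>z w. \<lbrakk>eqv s q z; s dvd w\<rbrakk> \<Longrightarrow> \<exists>z'\<in>X.
      (\<forall>t. t \<le> int w \<or> t \<ge> int (w + 2 * T + 2 * m) \<longrightarrow> dist (orb t z) (orb t z') \<le> e) \<and>
      (\<forall>j. \<bar>j\<bar> \<le> int m \<longrightarrow> dist (orb (int (w + T + m) + j) z') (orb j x) \<le> e)"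
proof -
  obtain d where d: "d > 0"
    "\<And>u. \<lbrakk>\<And>n. u n \<in> X; \<And>n. dist (u (n + 1)) (f (u n)) \<le> d\<rbrakk>
        \<Longrightarrow> \<exists>z\<in>X. \<forall>n. dist (u n) (orb n z) \<le> e"
    using shadowing[OF assms(1)] by metis
  obtain T where T: "s dvd T" "\<And>a b. \<lbrakk>eqv s q a; eqv s q b\<rbrakk> \<Longrightarrow> (step d ^^ T) a b"
    using mixing[OF d(1) assms(2-4)] by metis
  \<comment> \<open>The connecting chains begin and end at orbit times divisible by
    \<open>s\<close>, hence in the class of \<open>q\<close>, as mixing demands.\<close>
  have D_orb: "eqv s q (orb (int k) a)" "eqv s q (orb (- int k) a)" if k: "s dvd k" and a: "eqv s q a" for k a
  proof -
    obtain l where l: "k = s * l" using k ..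
    have "a \<in> X" using a by (simp add: eqv_def)
    then have "eqv s a (orb (int k) a)" "eqv s a (orb (- int k) a)"
      using eqv_orb[OF _ assms(2), of a "int l"] eqv_orb[OF _ assms(2), of a "- int l"] l by simp_all
    then show "eqv s q (orb (int k) a)" "eqv s q (orb (- int k) a)"
      using a eqv_trans by blast+
  qed
  have "\<exists>z'\<in>X. (\<forall>t. t \<le> int w \<or> t \<ge> int (w + 2 * T + 2 * m) \<longrightarrow> dist (orb t z) (orb t z') \<le> e) \<and>
      (\<forall>j. \<bar>j\<bar> \<le> int m \<longrightarrow> dist (orb (int (w + T + m) + j) z') (orb j x) \<le> e)"
    if z: "eqv s q z" and w: "s dvd w" for z w
  proof -
    let ?L = "w + 2 * T + 2 * m"
    have X: "z \<in> X" "x \<in> X" using z assms(5) by (auto simp: eqv_def)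
    have "s dvd ?L" using w T(1) assms(6) by simp
    then have 1: "(step d ^^ T) (orb (int w) z) (orb (- int m) x)"
      and 2: "(step d ^^ T) (orb (int m) x) (orb (int ?L) z)"
      using T(2) D_orb(1)[OF _ z] D_orb(1)[OF assms(6,5)] D_orb(2)[OF assms(6,5)] w by blast+
    from 1 obtain u1 where
      u1: "u1 0 = orb (int w) z" "u1 T = orb (- int m) x" "\<And>i. i < T \<Longrightarrow> step d (u1 i) (u1 (Suc i))"
      unfolding relpowp_fun_conv by blast
    from 2 obtain u2 where
      u2: "u2 0 = orb (int m) x" "u2 T = orb (int ?L) z" "\<And>i. i < T \<Longrightarrow> step d (u2 i) (u2 (Suc i))"
      unfolding relpowp_fun_conv by blast
    define v where "v t = (if t \<le> int w then orb t z else if t \<le> int (w + T) then u1 (nat (t - int w))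
      else if t \<le> int (w + T + 2 * m) then orb (t - int (w + T + m)) x
      else if t \<le> int ?L then u2 (nat (t - int (w + T + 2 * m))) else orb t z)" for t
    \<comment> \<open>The five formulas are stated on closed ranges that share end points, so that
      each single step lies inside one piece.\<close>
    have v1: "v t = orb t z" if "t \<le> int w" for t using that by (simp add: v_def)
    have v2: "v t = u1 (nat (t - int w))" if "int w \<le> t" "t \<le> int (w + T)" for t
      using that u1(1) by (cases "t = int w") (auto simp: v_def)
    have v3: "v t = orb (t - int (w + T + m)) x" if "int (w + T) \<le> t" "t \<le> int (w + T + 2 * m)" for t
    proof (cases "t = int (w + T)")
      case True
      then show ?thesis using v2[of t] u1(2) by simp
    qed (use that in \<open>simp add: v_def\<close>)
    have v4: "v t = u2 (nat (t - int (w + T + 2 * m)))" if "int (w + T + 2 * m) \<le> t" "t \<le> int ?L" for t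
    proof (cases "t = int (w + T + 2 * m)")
      case True
      then show ?thesis using v3[of t] u2(1) by simp
    qed (use that in \<open>simp add: v_def\<close>)
    have v5: "v t = orb t z" if "int ?L \<le> t" for t
    proof (cases "t = int ?L")
      case True
      then show ?thesis using v4[of t] u2(2) by simp
    qed (use that in \<open>simp add: v_def\<close>)
    have exact: "step d (orb t a) (orb (t + 1) a)" if "a \<in> X" for a t
      using that d(1) orb_Suc[OF that, of t] f_in[OF orb_in[OF that, of t]] orb_in[OF that, of t]
      by (simp add: step_def)
    have v: "step d (v t) (v (t + 1))" for t
    proof -
      consider "t < int w" | "int w \<le> t" "t < int (w + T)" | "int (w + T) \<le> t" "t < int (w + T + 2 * m)"
        | "int (w + T + 2 * m) \<le> t" "t < int ?L" | "int ?L \<le> t" by linarith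
      then show ?thesis
      proof cases
        case 1
        then show ?thesis using v1[of t] v1[of "t + 1"] exact[OF X(1)] by simp
      next
        case 2
        then have "nat (t + 1 - int w) = Suc (nat (t - int w))" "nat (t - int w) < T" by linarith+
        then show ?thesis using v2[of t] v2[of "t + 1"] 2 u1(3)[of "nat (t - int w)"] by simp
      next
        case 3
        have "t + 1 - int (w + T + m) = (t - int (w + T + m)) + 1" by simp
        then show ?thesis
          using v3[of t] v3[of "t + 1"] 3 exact[OF X(2), of "t - int (w + T + m)"] by (simp only:)
      next
        case 4
        let ?i = "nat (t - int (w + T + 2 * m))"
        have "nat (t + 1 - int (w + T + 2 * m)) = Suc ?i" "?i < T" using 4 by linarith+
        then show ?thesis using v4[of t] v4[of "t + 1"] 4 u2(3)[of ?i] by simp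
      next
        case 5
        then show ?thesis using v5[of t] v5[of "t + 1"] exact[OF X(1)] by simp
      qed
    qed
    obtain z' where z': "z' \<in> X" "\<And>t. dist (v t) (orb t z') \<le> e"
      using d(2)[of v] v by (auto simp: step_def)
    have "dist (orb t z) (orb t z') \<le> e" if "t \<le> int w \<or> t \<ge> int ?L" for t
      using z'(2)[of t] v1[of t] v5[of t] that by auto
    moreover have "dist (orb (int (w + T + m) + j) z') (orb j x) \<le> e" if "\<bar>j\<bar> \<le> int m" for j
    proof -
      have "v (int (w + T + m) + j) = orb j x" using v3[of "int (w + T + m) + j"] that by simp
      then show ?thesis using z'(2)[of "int (w + T + m) + j"] by (simp add: dist_commute)
    qed
    ultimately show ?thesis using z'(1) by blast
  qed
  then show thesis using that[of T] T(1) by blast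
qed

text \<open>In each window around a centre in \<open>C\<close> the orbit of \<open>z\<close> is cut
  out and that of \<open>y\<close> pasted in. The seams are small because both are close to the
  orbit of \<open>x\<close> there; one \<open>d\<close> serves for arbitrarily many windows.\<close>

lemma excursion_replacement:
  assumes "e > 0"
  obtains d where "d > 0"
    "\<And>x y z C m. \<lbrakk>x \<in> X; y \<in> X; z \<in> X; \<And>c c'. \<lbrakk>c \<in> C; c' \<in> C; c \<noteq> c'\<rbrakk> \<Longrightarrow> \<bar>c - c'\<bar> \<ge> 2 * m;
        \<And>c j. \<lbrakk>c \<in> C; \<bar>j\<bar> \<le> m\<rbrakk> \<Longrightarrow> dist (orb (c + j) z) (orb j x) \<le> d;
        \<And>j. \<bar>j\<bar> \<ge> m - 1 \<Longrightarrow> dist (orb j x) (orb j y) \<le> d\<rbrakk> \<Longrightarrow>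
      \<exists>z'\<in>X. (\<forall>t. (\<forall>c\<in>C. \<bar>t - c\<bar> \<ge> m) \<longrightarrow> dist (orb t z) (orb t z') \<le> e) \<and>
        (\<forall>c\<in>C. \<forall>j. \<bar>j\<bar> < m \<longrightarrow> dist (orb j y) (orb (c + j) z') \<le> e)"
proof -
  obtain d where d: "d > 0"
    "\<And>u. \<lbrakk>\<And>n. u n \<in> X; \<And>n. dist (u (n + 1)) (f (u n)) \<le> d\<rbrakk>
        \<Longrightarrow> \<exists>z\<in>X. \<forall>n. dist (u n) (orb n z) \<le> e"
    using shadowing[OF assms] by metis
  have "\<exists>z'\<in>X. (\<forall>t. (\<forall>c\<in>C. \<bar>t - c\<bar> \<ge> m) \<longrightarrow> dist (orb t z) (orb t z') \<le> e) \<and>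
        (\<forall>c\<in>C. \<forall>j. \<bar>j\<bar> < m \<longrightarrow> dist (orb j y) (orb (c + j) z') \<le> e)"
    if X: "x \<in> X" "y \<in> X" "z \<in> X" and C: "\<And>c c'. \<lbrakk>c \<in> C; c' \<in> C; c \<noteq> c'\<rbrakk> \<Longrightarrow> \<bar>c - c'\<bar> \<ge> 2 * m"
      and zx: "\<And>c j. \<lbrakk>c \<in> C; \<bar>j\<bar> \<le> m\<rbrakk> \<Longrightarrow> dist (orb (c + j) z) (orb j x) \<le> d / 2"
      and xy: "\<And>j. \<bar>j\<bar> \<ge> m - 1 \<Longrightarrow> dist (orb j x) (orb j y) \<le> d / 2" for x y z C m
  proof -
    define u where "u t = (if \<exists>c\<in>C. \<bar>t - c\<bar> < m then orb (t - (SOME c. c \<in> C \<and> \<bar>t - c\<bar> < m)) y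
      else orb t z)" for t
    have u_in: "u t = orb (t - c) y" if "c \<in> C" "\<bar>t - c\<bar> < m" for t c
    proof -
      let ?c = "SOME c. c \<in> C \<and> \<bar>t - c\<bar> < m"
      have "?c \<in> C \<and> \<bar>t - ?c\<bar> < m" by (rule someI[of _ c]) (use that in simp)
      \<comment> \<open>Centres are at least \<open>2 * m\<close> apart, so at most one is closer
        than \<open>m\<close> to \<open>t\<close>.\<close>
      then have "?c = c" using C[of ?c c] that by linarith
      then show ?thesis using that by (auto simp: u_def)
    qed
    have u_out: "u t = orb t z" if "\<And>c. c \<in> C \<Longrightarrow> \<bar>t - c\<bar> \<ge> m" for t
      using that by (force simp: u_def)
    have uX: "u t \<in> X" for t using X orb_in by (simp add: u_def)
    \<comment> \<open>The seams are at \<open>j = m\<close> on leaving a window and at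
      \<open>j = 1 - m\<close> on entering it, so the tail bound has to start at
      \<open>m - 1\<close>.\<close>
    have zy: "dist (orb (c + j) z) (orb j y) \<le> d" if "c \<in> C" "\<bar>j\<bar> \<le> m" "\<bar>j\<bar> \<ge> m - 1" for c j
      using zx[OF that(1,2)] xy[OF that(3)] dist_triangle[of "orb (c + j) z" "orb j y" "orb j x"] by simp
    have "dist (u (t + 1)) (f (u t)) \<le> d" for t
    proof (cases "\<exists>c\<in>C. \<bar>t - c\<bar> < m")
      case True
      then obtain c where c: "c \<in> C" "\<bar>t - c\<bar> < m" by blast
      have fu: "f (u t) = orb (t + 1 - c) y"
        using u_in[OF c] orb_Suc[OF X(2), of "t - c"] by (simp add: algebra_simps)
      show ?thesis
      proof (cases "\<bar>t + 1 - c\<bar> < m")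
        case True
        then show ?thesis using u_in[OF c(1), of "t + 1"] fu d(1) by simp
      next
        case False
        then have t: "t + 1 - c = m" using c(2) by linarith
        have "u (t + 1) = orb (t + 1) z"
        proof (rule u_out)
          fix c' assume "c' \<in> C"
          then show "\<bar>t + 1 - c'\<bar> \<ge> m" using C[of c c'] c t by (cases "c = c'") auto
        qed
        moreover have "c + m = t + 1" using t by simp
        moreover have "dist (orb (c + m) z) (orb m y) \<le> d" using zy[OF c(1), of m] c(2) by simp
        ultimately show ?thesis using fu t by metis
      qed
    next
      case False
      then have "u t = orb t z" by (intro u_out) force
      then have fu: "f (u t) = orb (t + 1) z" using orb_Suc[OF X(3), of t] by simp
      show ?thesis
      proof (cases "\<exists>c\<in>C. \<bar>t + 1 - c\<bar> < m")
        case True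
        then obtain c where c: "c \<in> C" "\<bar>t + 1 - c\<bar> < m" by blast
        moreover have "\<bar>t - c\<bar> \<ge> m" using False c by force
        ultimately have "\<bar>t + 1 - c\<bar> \<ge> m - 1" by linarith
        then show ?thesis using fu u_in[OF c] zy[OF c(1), of "t + 1 - c"] c(2) by (simp add: dist_commute)
      next
        case False
        then have "u (t + 1) = orb (t + 1) z" by (intro u_out) force
        then show ?thesis using fu d(1) by simp
      qed
    qed
    then obtain z' where z': "z' \<in> X" "\<And>t. dist (u t) (orb t z') \<le> e"
      using d(2) uX by blast
    have "dist (orb t z) (orb t z') \<le> e" if "\<forall>c\<in>C. \<bar>t - c\<bar> \<ge> m" for t
      using z'(2)[of t] u_out[of t] that by simp
    moreover have "dist (orb j y) (orb (c + j) z') \<le> e" if "c \<in> C" "\<bar>j\<bar> < m" for c j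
      using z'(2)[of "c + j"] u_in[of c "c + j"] that by simp
    ultimately show ?thesis using z'(1) by blast
  qed
  then show thesis using that[of "d / 2"] d(1) by simp
qed

section \<open>The Moore property\<close>

lemma homoclinic_tail:
  assumes "homoclinic X f x y" "e > 0"
  obtains m :: nat where "\<And>j. \<bar>j\<bar> \<ge> int m \<Longrightarrow> dist (orb j x) (orb j y) \<le> e"
proof -
  have "\<forall>\<^sub>F j in filtercomap abs at_top. dist (orb j x) (orb j y) < e"
    using assms unfolding homoclinic_def by (rule order_tendstoD)
  then obtain P where P: "\<forall>\<^sub>F k :: int in at_top. P k"
    "\<And>j. P \<bar>j\<bar> \<Longrightarrow> dist (orb j x) (orb j y) < e"
    by (auto simp: eventually_filtercomap)
  then obtain N where N: "\<And>k. k \<ge> N \<Longrightarrow> P k" by (auto simp: eventually_at_top_linorder)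
  show thesis
  proof (rule that[of "nat N"])
    fix j :: int assume "\<bar>j\<bar> \<ge> int (nat N)"
    then have "\<bar>j\<bar> \<ge> N" by linarith
    then show "dist (orb j x) (orb j y) \<le> e" using N P(2) by (meson less_imp_le)
  qed
qed

lemma window_separation:
  fixes i i' L :: nat
  assumes "i \<noteq> i'"
  shows "\<bar>int (i * L) - int (i' * L)\<bar> \<ge> int L"
proof -
  have *: "a * L + L \<le> b * L" if "a < b" for a b :: nat
    using mult_le_mono1[of "Suc a" b L] that by simp
  show ?thesis using *[of i i'] *[of i' i] assms by linarith
qed

text \<open>Since \<open>g x = g y\<close>, exchanging excursions along \<open>x\<close> for
  excursions along \<open>y\<close> hardly changes the image under \<open>g\<close>. Thus a preimage
  can be altered to avoid \<open>x\<close> in all prescribed windows at once.\<close>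

lemma surjective_lift_avoiding:
  assumes g: "endomorphism X f g" and x: "x \<in> X" and y: "y \<in> X"
    and hom: "homoclinic X f x y" and gxy: "g x = g y"
    and e: "e > 0" and \<epsilon>: "\<epsilon> > 0" and \<theta>: "\<theta> > 0" "2 * \<theta> \<le> \<eta>" "2 * \<theta> < dist x y"
  obtains M :: nat where
    "\<And>z m c I. \<lbrakk>z \<in> X; M \<le> m; \<And>i i'. \<lbrakk>i \<in> I; i' \<in> I; i \<noteq> i'\<rbrakk> \<Longrightarrow> \<bar>c i - c i'\<bar> \<ge> 2 * int m;
        \<And>i. i \<in> I \<Longrightarrow> c i \<ge> int m\<rbrakk> \<Longrightarrow>
      \<exists>z'\<in>X. dist z z' \<le> e \<and> (\<forall>t. dist (orb t (g z)) (orb t (g z')) \<le> \<epsilon>) \<and>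
        (\<forall>i\<in>I. \<exists>j. \<bar>j\<bar> \<le> int m \<and> dist (orb (c i + j) z') (orb j x) > \<theta>)"
proof -
  have gX: "g a \<in> X" if "a \<in> X" for a using g that by (auto simp: endomorphism_def)
  obtain \<mu> where \<mu>: "\<mu> > 0" "\<And>x y. \<lbrakk>x \<in> X; y \<in> X; dist x y \<le> \<mu>\<rbrakk> \<Longrightarrow> dist (g x) (g y) \<le> \<epsilon> / 2"
    using uniform_modulus[of g "\<epsilon> / 2"] g \<epsilon> by (auto simp: endomorphism_def)
  \<comment> \<open>The bound \<open>\<theta>\<close> preserves distance from \<open>x\<close>,
    \<open>\<mu>\<close> controls the image under \<open>g\<close>, and \<open>e\<close> keeps
    \<open>z'\<close> near \<open>z\<close>.\<close>
  define \<alpha> where "\<alpha> = min (min \<theta> \<mu>) e"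
  have \<alpha>: "\<alpha> > 0" "\<alpha> \<le> \<theta>" "\<alpha> \<le> \<mu>" "\<alpha> \<le> e" using \<theta> \<mu> e by (auto simp: \<alpha>_def)
  obtain d where d: "d > 0"
    "\<And>x y z C m. \<lbrakk>x \<in> X; y \<in> X; z \<in> X; \<And>c c'. \<lbrakk>c \<in> C; c' \<in> C; c \<noteq> c'\<rbrakk> \<Longrightarrow> \<bar>c - c'\<bar> \<ge> 2 * m;
        \<And>c j. \<lbrakk>c \<in> C; \<bar>j\<bar> \<le> m\<rbrakk> \<Longrightarrow> dist (orb (c + j) z) (orb j x) \<le> d;
        \<And>j. \<bar>j\<bar> \<ge> m - 1 \<Longrightarrow> dist (orb j x) (orb j y) \<le> d\<rbrakk> \<Longrightarrow>
      \<exists>z'\<in>X. (\<forall>t. (\<forall>c\<in>C. \<bar>t - c\<bar> \<ge> m) \<longrightarrow> dist (orb t z) (orb t z') \<le> \<alpha>) \<and>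
        (\<forall>c\<in>C. \<forall>j. \<bar>j\<bar> < m \<longrightarrow> dist (orb j y) (orb (c + j) z') \<le> \<alpha>)"
    by (rule excursion_replacement[OF \<alpha>(1)]) blast
  define \<kappa> where "\<kappa> = min d \<mu>"
  have \<kappa>: "\<kappa> > 0" "\<kappa> \<le> d" "\<kappa> \<le> \<mu>" using d(1) \<mu>(1) by (auto simp: \<kappa>_def)
  obtain r :: nat where r: "\<And>x y. \<lbrakk>x \<in> X; y \<in> X;
      \<And>j. \<bar>j\<bar> \<le> int r \<Longrightarrow> dist (orb j x) (orb j y) \<le> \<eta>\<rbrakk> \<Longrightarrow> dist x y \<le> \<kappa>"
    using uniform_expansivity[OF \<kappa>(1)] by metis
  obtain m0 :: nat where m0: "\<And>j. \<bar>j\<bar> \<ge> int m0 \<Longrightarrow> dist (orb j x) (orb j y) \<le> d"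
    using homoclinic_tail[OF hom d(1)] by metis
  \<comment> \<open>The increment makes \<open>M - 1\<close> reach the homoclinic tail and keeps
    \<open>M\<close> positive, so that the centre of a window is really replaced.\<close>
  define M where "M = int m0 + 1"
  have "\<exists>z'\<in>X. dist z z' \<le> e \<and> (\<forall>t. dist (orb t (g z)) (orb t (g z')) \<le> \<epsilon>) \<and>
        (\<forall>i\<in>I. \<exists>j. \<bar>j\<bar> \<le> int m \<and> dist (orb (c i + j) z') (orb j x) > \<theta>)"
    if z: "z \<in> X" and m: "nat M + r \<le> m"
      and sep: "\<And>i i'. \<lbrakk>i \<in> I; i' \<in> I; i \<noteq> i'\<rbrakk> \<Longrightarrow> \<bar>c i - c i'\<bar> \<ge> 2 * int m"
      and c: "\<And>i. i \<in> I \<Longrightarrow> c i \<ge> int m" for z m c and I :: "'b set"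
  proof -
    have M: "M > 0" "M + int r \<le> int m" using m by (auto simp: M_def)
    \<comment> \<open>Only windows in which \<open>z\<close> follows \<open>x\<close> within
      \<open>2 * \<theta>\<close> are altered; afterwards the orbit is near \<open>y\<close> at
      their centres. In every other window some time has distance above \<open>2 * \<theta>\<close>
      from \<open>x\<close>, and the alteration costs at most \<open>\<theta>\<close> of it.\<close>
    define J where "J = {i \<in> I. \<forall>j. \<bar>j\<bar> \<le> int m \<longrightarrow> dist (orb (c i + j) z) (orb j x) \<le> 2 * \<theta>}"
    \<comment> \<open>\<open>\<theta>\<close> need not be small compared with \<open>d\<close>: an orbit \<open>2 * \<theta>\<close>-close to that of \<open>x\<close> for
      \<open>\<bar>j\<bar> \<le> m\<close> is, by expansivity, \<open>\<kappa>\<close>-close to it for \<open>\<bar>j\<bar> \<le> M\<close>, which is where it is spliced.\<close>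
    have zx: "dist (orb (c i + j) z) (orb j x) \<le> \<kappa>" if "i \<in> J" "\<bar>j\<bar> \<le> M" for i j
    proof (rule r)
      fix k assume "\<bar>k\<bar> \<le> int r"
      then have "\<bar>k + j\<bar> \<le> int m" using that M by linarith
      then have "dist (orb (c i + (k + j)) z) (orb (k + j) x) \<le> 2 * \<theta>"
        using that by (simp add: J_def)
      then show "dist (orb k (orb (c i + j) z)) (orb k (orb j x)) \<le> \<eta>"
        using \<theta>(2) orb_add[OF z, of k "c i + j"] orb_add[OF x, of k j] by (simp add: ac_simps)
    qed (use orb_in z x in auto)
    have "\<exists>z'\<in>X. (\<forall>t. (\<forall>a\<in>c ` J. \<bar>t - a\<bar> \<ge> M) \<longrightarrow> dist (orb t z) (orb t z') \<le> \<alpha>) \<and>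
        (\<forall>a\<in>c ` J. \<forall>j. \<bar>j\<bar> < M \<longrightarrow> dist (orb j y) (orb (a + j) z') \<le> \<alpha>)"
    proof (rule d(2)[OF x y z])
      fix a a' assume "a \<in> c ` J" "a' \<in> c ` J" "a \<noteq> a'"
      then obtain i i' where "i \<in> I" "i' \<in> I" "a = c i" "a' = c i'" "i \<noteq> i'" by (auto simp: J_def)
      then show "2 * M \<le> \<bar>a - a'\<bar>" using sep[of i i'] M by linarith
    next
      fix a j assume "a \<in> c ` J" "\<bar>j\<bar> \<le> M"
      then show "dist (orb (a + j) z) (orb j x) \<le> d" using zx \<kappa>(2) by fastforce
    next
      fix j assume "M - 1 \<le> \<bar>j\<bar>"
      then show "dist (orb j x) (orb j y) \<le> d" using m0 by (simp add: M_def)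
    qed
    then obtain z' where z': "z' \<in> X"
      "\<And>t. (\<And>i. i \<in> J \<Longrightarrow> \<bar>t - c i\<bar> \<ge> M) \<Longrightarrow> dist (orb t z) (orb t z') \<le> \<alpha>"
      "\<And>i j. i \<in> J \<Longrightarrow> \<bar>j\<bar> < M \<Longrightarrow> dist (orb j y) (orb (c i + j) z') \<le> \<alpha>"
      by auto
    \<comment> \<open>All centres are at least \<open>m\<close>, so time 0 lies outside the altered
      windows. The closeness of \<open>z'\<close> to \<open>z\<close> later keeps the lift in its
      class.\<close>
    have "dist (orb 0 z) (orb 0 z') \<le> \<alpha>"
    proof (rule z'(2))
      fix i assume "i \<in> J"
      then show "\<bar>0 - c i\<bar> \<ge> M" using c[of i] M by (simp add: J_def)
    qed
    then have "dist z z' \<le> e" using \<alpha>(4) by (simp add: orb_0)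
    moreover have "dist (orb t (g z)) (orb t (g z')) \<le> \<epsilon>" for t
    proof -
      have g_orb: "orb t (g a) = g (orb t a)" if "a \<in> X" for a t
        using orb_commute[OF g that] by simp
      show ?thesis
      proof (cases "\<exists>i\<in>J. \<bar>t - c i\<bar> < M")
        case True
        then obtain i where i: "i \<in> J" "\<bar>t - c i\<bar> < M" by blast
        define j where "j = t - c i"
        have j: "t = c i + j" "\<bar>j\<bar> < M" using i by (auto simp: j_def)
        have "dist (orb t z) (orb j x) \<le> \<mu>" using zx[OF i(1), of j] j \<kappa>(3) by simp
        then have 1: "dist (g (orb t z)) (g (orb j x)) \<le> \<epsilon> / 2" using \<mu>(2) orb_in x z by blast
        have "dist (orb j y) (orb t z') \<le> \<mu>" using z'(3)[OF i(1) j(2)] j(1) \<alpha>(3) by simp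
        then have 2: "dist (g (orb j y)) (g (orb t z')) \<le> \<epsilon> / 2" using \<mu>(2) orb_in y z'(1) by blast
        have "g (orb j x) = g (orb j y)" using g_orb x y gxy by metis
        then show ?thesis
          using 1 2 g_orb[OF z] g_orb[OF z'(1)] dist_triangle[of "g (orb t z)" "g (orb t z')" "g (orb j x)"]
          by simp
      next
        case False
        then have "dist (orb t z) (orb t z') \<le> \<alpha>" by (intro z'(2)) (meson not_less)
        then have "dist (g (orb t z)) (g (orb t z')) \<le> \<epsilon> / 2"
          using \<mu>(2) orb_in z z'(1) \<alpha>(3) by simp
        then show ?thesis using g_orb[OF z] g_orb[OF z'(1)] \<epsilon> by simp
      qed
    qed
    moreover have "\<exists>j. \<bar>j\<bar> \<le> int m \<and> dist (orb (c i + j) z') (orb j x) > \<theta>" if i: "i \<in> I" for i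
    proof (cases "i \<in> J")
      case True
      then have "dist y (orb (c i) z') \<le> \<theta>" using z'(3)[OF True, of 0] M(1) \<alpha>(2) by (simp add: orb_0)
      then have "dist (orb (c i + 0) z') (orb 0 x) > \<theta>"
        using \<theta>(3) dist_triangle2[of x y "orb (c i) z'"] by (simp add: orb_0 dist_commute)
      then show ?thesis by (intro exI[of _ 0]) simp
    next
      case False
      then obtain j where j: "\<bar>j\<bar> \<le> int m" "dist (orb (c i + j) z) (orb j x) > 2 * \<theta>"
        using i by (auto simp: J_def not_le)
      have "dist (orb (c i + j) z) (orb (c i + j) z') \<le> \<alpha>"
      proof (rule z'(2))
        fix i' assume "i' \<in> J"
        then have "\<bar>c i - c i'\<bar> \<ge> 2 * int m" using sep[OF i, of i'] False by (auto simp: J_def)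
        then show "\<bar>c i + j - c i'\<bar> \<ge> M" using j(1) M by linarith
      qed
      then have "dist (orb (c i + j) z') (orb j x) > \<theta>"
        using j(2) \<alpha>(2) dist_triangle[of "orb (c i + j) z" "orb j x" "orb (c i + j) z'"] by simp
      then show ?thesis using j(1) by blast
    qed
    ultimately show ?thesis using z'(1) by blast
  qed
  then show thesis by (rule that[of "nat M + r"])
qed

text \<open>One insertion in any of \<open>N\<close> windows multiplies the number of points by
  \<open>N\<close>, while undoing it needs a number of labels independent of \<open>N\<close>. The
  chosen window is recognisable because the lifts avoid \<open>x\<close> in every window.\<close>

lemma no_collapsed_homoclinic_pair:
  assumes g: "endomorphism X f g" and s: "s > 0" and q: "q \<in> X" "orb (int s) q = q"
    and gD: "g ` {a. eqv s q a} = {a. eqv s q a}"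
    and xD: "eqv s q x" and y: "y \<in> X" and hom: "homoclinic X f x y" and gxy: "g x = g y"
  shows "x = y"
proof (rule ccontr)
  assume "x \<noteq> y"
  let ?D = "{a. eqv s q a}"
  have DX: "?D \<subseteq> X" by (auto simp: eqv_def)
  then have x: "x \<in> X" using xD by blast
  obtain \<rho> where \<rho>: "\<rho> > 0" "\<And>a b. \<lbrakk>a \<in> X; b \<in> X; dist a b \<le> \<rho>\<rbrakk> \<Longrightarrow> eqv s a b"
    using eqv_near s by metis
  have nearD: "b \<in> ?D" if "a \<in> ?D" "b \<in> X" "dist a b \<le> \<rho>" for a b
    using that \<rho>(2)[of a b] DX eqv_trans by blast
  define \<theta> where "\<theta> = min \<eta> (dist x y) / 4"
  have \<theta>: "\<theta> > 0" "2 * \<theta> \<le> \<eta>" "2 * \<theta> < dist x y"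
    using eta_pos \<open>x \<noteq> y\<close> by (auto simp: \<theta>_def min_def)
  have "\<eta> / 12 > 0" using eta_pos by simp
  then obtain \<mu> where \<mu>: "\<mu> > 0"
    "\<And>x y. \<lbrakk>x \<in> X; y \<in> X; dist x y \<le> \<mu>\<rbrakk> \<Longrightarrow> dist (g x) (g y) \<le> \<eta> / 12"
    using uniform_modulus[of g "\<eta> / 12"] g unfolding endomorphism_def by metis
  have "\<eta> / 6 > 0" using eta_pos by simp
  obtain M :: nat where M:
    "\<And>z m c I. \<lbrakk>z \<in> X; M \<le> m; \<And>i i'. \<lbrakk>i \<in> I; i' \<in> I; i \<noteq> i'\<rbrakk> \<Longrightarrow> \<bar>c i - c i'\<bar> \<ge> 2 * int m;
        \<And>i. i \<in> I \<Longrightarrow> c i \<ge> int m\<rbrakk> \<Longrightarrow>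
      \<exists>z'\<in>X. dist z z' \<le> \<rho> \<and> (\<forall>t. dist (orb t (g z)) (orb t (g z')) \<le> \<eta> / 6) \<and>
        (\<forall>i\<in>(I :: nat set). \<exists>j. \<bar>j\<bar> \<le> int m \<and> dist (orb (c i + j) z') (orb j x) > \<theta>)"
    by (rule surjective_lift_avoiding[OF g x y hom gxy \<rho>(1) \<open>\<eta> / 6 > 0\<close> \<theta>]) blast
  define m where "m = s * M"
  have m: "M \<le> m" "s dvd m" using s by (auto simp: m_def)
  \<comment> \<open>Three errors of size \<open>\<kappa>\<close> add up when comparing with
    \<open>x\<close> (bounded by \<open>\<theta>\<close>) and when comparing two lifts (bounded by
    \<open>\<mu>\<close>).\<close>
  define \<kappa> where "\<kappa> = min (min \<theta> \<mu>) \<rho> / 4"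
  have \<kappa>: "\<kappa> > 0" "3 * \<kappa> \<le> \<theta>" "3 * \<kappa> \<le> \<mu>" "\<kappa> \<le> \<rho>"
    using \<theta>(1) \<mu>(1) \<rho>(1) by (auto simp: \<kappa>_def min_def)
  obtain T where T: "s dvd T" "\<And>z w. \<lbrakk>eqv s q z; s dvd w\<rbrakk> \<Longrightarrow> \<exists>z'\<in>X.
      (\<forall>t. t \<le> int w \<or> t \<ge> int (w + 2 * T + 2 * m) \<longrightarrow> dist (orb t z) (orb t z') \<le> \<kappa>) \<and>
      (\<forall>j. \<bar>j\<bar> \<le> int m \<longrightarrow> dist (orb (int (w + T + m) + j) z') (orb j x) \<le> \<kappa>)"
    by (rule excursion_insertion[OF \<kappa>(1) s q xD m(2)]) blast
  define L where "L = 2 * T + 2 * m"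
  have sL: "s dvd L" using T(1) m(2) by (simp add: L_def)
  obtain r :: nat where r: "\<And>x y. \<lbrakk>x \<in> X; y \<in> X;
      \<And>j. \<bar>j\<bar> \<le> int r \<Longrightarrow> dist (orb j x) (orb j y) \<le> \<eta>\<rbrakk> \<Longrightarrow> dist x y \<le> \<kappa>"
    using uniform_expansivity[OF \<kappa>(1)] by metis
  obtain P :: "'a set" and h where P: "finite P" "\<And>x. x \<in> X \<Longrightarrow> h x \<in> P"
    "\<And>x y j. \<lbrakk>x \<in> X; y \<in> X; h x = h y; \<bar>j\<bar> \<le> int r\<rbrakk> \<Longrightarrow> dist (orb j x) (orb j y) \<le> \<kappa>"
    by (rule orbit_coding[OF \<kappa>(1), of r]) blast
  obtain Q :: "'a set" and k where Q: "finite Q" "\<And>x. x \<in> X \<Longrightarrow> k x \<in> Q"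
    "\<And>x y j. \<lbrakk>x \<in> X; y \<in> X; k x = k y; \<bar>j\<bar> \<le> int L\<rbrakk> \<Longrightarrow> dist (orb j x) (orb j y) \<le> \<mu>"
    by (rule orbit_coding[OF \<mu>(1), of L]) blast
  \<comment> \<open>The codes \<open>P\<close> and \<open>Q\<close> depend on radii,
    \<open>r\<close> and the window length \<open>L\<close> only, so \<open>N\<close> may be chosen
    after them.\<close>
  define N where "N = card P * card P * card Q + 1"
  define n where "n = N * L"
  have "\<eta> / 2 > 0" using eta_pos by simp
  obtain E where E: "finite E" "E \<subseteq> ?D"
    "\<And>a b. \<lbrakk>a \<in> E; b \<in> E; \<And>t. 0 \<le> t \<Longrightarrow> t < int n \<Longrightarrow> dist (orb t a) (orb t b) \<le> \<eta> / 2\<rbrakk> \<Longrightarrow> a = b"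
    "\<And>a. a \<in> ?D \<Longrightarrow> \<exists>b\<in>E. \<forall>t. 0 \<le> t \<longrightarrow> t < int n \<longrightarrow> dist (orb t a) (orb t b) \<le> \<eta> / 2"
    by (rule maximal_separated[OF DX \<open>\<eta> / 2 > 0\<close>, of n]) blast
  \<comment> \<open>\<open>c i\<close> is the centre of the window \<open>{i * L..i * L + L}\<close>: \<open>T\<close> steps lead to the excursion,
    which lasts \<open>2 * m\<close> steps, and \<open>T\<close> steps lead back.\<close>
  define c where "c i = int (i * L + T + m)" for i
  have lift: "\<exists>z\<in>?D. (\<forall>t. dist (orb t e) (orb t (g z)) \<le> \<eta> / 6) \<and>
      (\<forall>i. \<exists>j. \<bar>j\<bar> \<le> int m \<and> dist (orb (c i + j) z) (orb j x) > \<theta>)" if e: "e \<in> E" for e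
  proof -
    obtain z where z: "z \<in> ?D" "g z = e" using e E(2) gD by (metis imageE subsetD)
    have "\<exists>z'\<in>X. dist z z' \<le> \<rho> \<and> (\<forall>t. dist (orb t (g z)) (orb t (g z')) \<le> \<eta> / 6) \<and>
        (\<forall>i\<in>UNIV. \<exists>j. \<bar>j\<bar> \<le> int m \<and> dist (orb (c i + j) z') (orb j x) > \<theta>)"
    proof (rule M[OF _ m(1)])
      fix i i' :: nat assume "i \<noteq> i'"
      then show "\<bar>c i - c i'\<bar> \<ge> 2 * int m"
        using window_separation[of i i' L] by (simp add: c_def L_def)
    qed (use z DX in \<open>auto simp: c_def\<close>)
    then show ?thesis using nearD[OF z(1)] z(2) by auto
  qed
  then obtain Z where Z: "\<And>e. e \<in> E \<Longrightarrow> Z e \<in> ?D"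
    "\<And>e t. e \<in> E \<Longrightarrow> dist (orb t e) (orb t (g (Z e))) \<le> \<eta> / 6"
    "\<And>e i. e \<in> E \<Longrightarrow> \<exists>j. \<bar>j\<bar> \<le> int m \<and> dist (orb (c i + j) (Z e)) (orb j x) > \<theta>"
    by metis
  have "\<exists>w\<in>?D. (\<forall>t. t \<le> int (i * L) \<or> t \<ge> int (i * L + L) \<longrightarrow> dist (orb t (Z e)) (orb t w) \<le> \<kappa>) \<and>
      (\<forall>j. \<bar>j\<bar> \<le> int m \<longrightarrow> dist (orb (c i + j) w) (orb j x) \<le> \<kappa>)" if e: "e \<in> E" for e i
  proof -
    have "s dvd i * L" using sL by simp
    then obtain w where w: "w \<in> X"
      "\<And>t. t \<le> int (i * L) \<or> t \<ge> int (i * L + L) \<Longrightarrow> dist (orb t (Z e)) (orb t w) \<le> \<kappa>"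
      "\<And>j. \<bar>j\<bar> \<le> int m \<Longrightarrow> dist (orb (c i + j) w) (orb j x) \<le> \<kappa>"
      using T(2)[of "Z e" "i * L"] Z(1)[OF e] unfolding c_def L_def by (auto simp: add.assoc)
    have "dist (Z e) w \<le> \<rho>" using w(2)[of 0] \<kappa>(4) by (simp add: orb_0)
    then show ?thesis using nearD[OF Z(1)[OF e] w(1)] w by blast
  qed
  then obtain W where W: "\<And>e i. e \<in> E \<Longrightarrow> W e i \<in> ?D"
    "\<And>e i t. \<lbrakk>e \<in> E; t \<le> int (i * L) \<or> t \<ge> int (i * L + L)\<rbrakk> \<Longrightarrow> dist (orb t (Z e)) (orb t (W e i)) \<le> \<kappa>"
    "\<And>e i j. \<lbrakk>e \<in> E; \<bar>j\<bar> \<le> int m\<rbrakk> \<Longrightarrow> dist (orb (c i + j) (W e i)) (orb j x) \<le> \<kappa>"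
    by metis
  obtain V where V: "\<And>a. a \<in> ?D \<Longrightarrow> V a \<in> E"
    "\<And>a t. \<lbrakk>a \<in> ?D; 0 \<le> t; t < int n\<rbrakk> \<Longrightarrow> dist (orb t a) (orb t (V a)) \<le> \<eta> / 2"
    using E(4) by metis
  \<comment> \<open>\<open>V\<close> records the nearest point of \<open>E\<close>, the two values
    of \<open>h\<close> control both ends of the time interval, and \<open>k\<close> restores the
    stretch of \<open>Z e\<close> overwritten by the excursion.\<close>
  define \<Phi> where "\<Phi> = (\<lambda>(e, i). (V (W e i), h (W e i), h (orb (int n) (W e i)), k (orb (int (i * L)) (Z e))))"
  have inj: "inj_on \<Phi> (E \<times> {..<N})"
  proof (rule inj_onI)
    fix p p' assume "p \<in> E \<times> {..<N}" "p' \<in> E \<times> {..<N}" and \<Phi>: "\<Phi> p = \<Phi> p'"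
    then obtain e i e' i' where p: "p = (e, i)" "p' = (e', i')"
      and e: "e \<in> E" "e' \<in> E" and i: "i < N" "i' < N" by auto
    have eq: "\<Phi> (e, i) = \<Phi> (e', i')" using \<Phi> p by simp
    define a b where "a = W e i" and "b = W e' i'"
    have ab: "a \<in> ?D" "b \<in> ?D" "a \<in> X" "b \<in> X" using W(1) e DX by (auto simp: a_def b_def)
    have eqs: "V a = V b" "h a = h b" "h (orb (int n) a) = h (orb (int n) b)"
      "k (orb (int (i * L)) (Z e)) = k (orb (int (i' * L)) (Z e'))"
      using eq by (auto simp: \<Phi>_def a_def b_def)
    have ab_eta: "dist (orb t a) (orb t b) \<le> \<eta>" if "0 \<le> t" "t < int n" for t
      using V(2)[OF ab(1) that] V(2)[OF ab(2) that] eqs(1)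
        dist_triangle2[of "orb t a" "orb t b" "orb t (V a)"] by simp
    \<comment> \<open>In the interior, \<open>\<eta>\<close>-closeness at the \<open>r\<close> times
      before and after gives \<open>\<kappa>\<close>-closeness. Near the ends those times leave the
      interval, and the codes take over.\<close>
    have ab_close: "dist (orb t a) (orb t b) \<le> \<kappa>" if t: "0 \<le> t" "t \<le> int n" for t
    proof -
      consider "t \<le> int r" | "t \<ge> int n - int r" | "int r < t" "t < int n - int r" by linarith
      then show ?thesis
      proof cases
        case 1
        then show ?thesis using P(3)[OF ab(3,4) eqs(2), of t] t by simp
      next
        case 2
        then have "dist (orb (t - int n) (orb (int n) a)) (orb (t - int n) (orb (int n) b)) \<le> \<kappa>"
          using t by (intro P(3) eqs(3)) (use ab orb_in in auto)
        then show ?thesis using orb_add[OF ab(3), of "t - int n" "int n"]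
            orb_add[OF ab(4), of "t - int n" "int n"] by simp
      next
        case 3
        show ?thesis
        proof (rule r)
          fix j assume "\<bar>j\<bar> \<le> int r"
          then have "0 \<le> j + t" "j + t < int n" using 3 by linarith+
          then show "dist (orb j (orb t a)) (orb j (orb t b)) \<le> \<eta>"
            using ab_eta[of "j + t"] orb_add[OF ab(3), of j t] orb_add[OF ab(4), of j t] by simp
        qed (use ab orb_in in auto)
      qed
    qed
    have outside: "dist (orb t (Z e)) (orb t b) \<le> 2 * \<kappa>"
      if "0 \<le> t" "t \<le> int n" "t \<le> int (i * L) \<or> t \<ge> int (i * L + L)" for t
      using W(2)[OF e(1) that(3)] ab_close[OF that(1,2)]
        dist_triangle[of "orb t (Z e)" "orb t b" "orb t a"] by (simp add: a_def)
    have bounds: "int (i * L + L) \<le> int n"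
    proof -
      have "Suc i * L \<le> n" unfolding n_def using i by (intro mult_le_mono1) simp
      then show ?thesis unfolding of_nat_le_iff by simp
    qed
    have bounds': "int (i' * L + L) \<le> int n"
    proof -
      have "Suc i' * L \<le> n" unfolding n_def using i by (intro mult_le_mono1) simp
      then show ?thesis unfolding of_nat_le_iff by simp
    qed
    \<comment> \<open>If the windows differed, \<open>Z e\<close> would be
      \<open>2 * \<kappa>\<close>-close to \<open>b\<close> throughout window \<open>i'\<close>,
      where \<open>b\<close> follows \<open>x\<close>. Hence \<open>Z e\<close> would follow
      \<open>x\<close> within \<open>\<theta>\<close> there, which lifts avoid.\<close>
    have ii: "i = i'"
    proof (rule ccontr)
      assume "i \<noteq> i'"
      then have sep: "\<bar>int (i * L) - int (i' * L)\<bar> \<ge> int L" by (rule window_separation)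
      obtain j where j: "\<bar>j\<bar> \<le> int m" "dist (orb (c i' + j) (Z e)) (orb j x) > \<theta>"
        using Z(3)[OF e(1)] by blast
      define w' where "w' = int (i' * L)"
      have "0 \<le> w'" "w' + int L \<le> int n" "c i' = w' + int T + int m" "int L = 2 * int T + 2 * int m"
        using bounds' by (simp_all add: w'_def c_def L_def)
      then have "0 \<le> c i' + j" "c i' + j \<le> int n" "w' \<le> c i' + j" "c i' + j \<le> w' + int L"
        using j(1) by linarith+
      moreover from this have "c i' + j \<le> int (i * L) \<or> c i' + j \<ge> int (i * L + L)"
        using sep unfolding w'_def of_nat_add by linarith
      ultimately have "dist (orb (c i' + j) (Z e)) (orb (c i' + j) b) \<le> 2 * \<kappa>" by (intro outside)
      moreover have "dist (orb (c i' + j) b) (orb j x) \<le> \<kappa>" using W(3)[OF e(2) j(1)] by (simp add: b_def)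
      ultimately show False
        using j(2) \<kappa>(2) dist_triangle[of "orb (c i' + j) (Z e)" "orb j x" "orb (c i' + j) b"] by simp
    qed
    \<comment> \<open>Outside the common window the two lifts are compared through \<open>a\<close>
      and \<open>b\<close>; inside it through the code \<open>k\<close>.\<close>
    have zz: "dist (orb t (Z e)) (orb t (Z e')) \<le> \<mu>" if t: "0 \<le> t" "t < int n" for t
    proof (cases "t \<le> int (i * L) \<or> t \<ge> int (i * L + L)")
      case True
      then have "dist (orb t (Z e')) (orb t b) \<le> \<kappa>" using W(2)[OF e(2)] ii by (simp add: b_def)
      then show ?thesis using outside[of t] t True \<kappa>(3)
          dist_triangle2[of "orb t (Z e)" "orb t (Z e')" "orb t b"] by simp
    next
      case False
      let ?w = "int (i * L)"
      have X: "Z e \<in> X" "Z e' \<in> X" using Z(1) e DX by auto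
      have "dist (orb (t - ?w) (orb ?w (Z e))) (orb (t - ?w) (orb ?w (Z e'))) \<le> \<mu>"
        by (rule Q(3)) (use False eqs(4) ii X orb_in in auto)
      then show ?thesis using orb_add[OF X(1), of "t - ?w" ?w] orb_add[OF X(2), of "t - ?w" ?w] by simp
    qed
    have "e = e'"
    proof (rule E(3)[OF e])
      fix t assume t: "0 \<le> t" "t < int n"
      have X: "Z e \<in> X" "Z e' \<in> X" using Z(1) e DX by auto
      have "dist (g (orb t (Z e))) (g (orb t (Z e'))) \<le> \<eta> / 12"
        using \<mu>(2) zz[OF t] X orb_in by blast
      then have "dist (orb t (g (Z e))) (orb t (g (Z e'))) \<le> \<eta> / 12"
        using orb_commute[OF g X(1)] orb_commute[OF g X(2)] by simp
      \<comment> \<open>The errors are \<open>\<eta> / 6 + \<eta> / 12 + \<eta> / 6\<close>, which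
        is below the separation \<open>\<eta> / 2\<close> of \<open>E\<close>.\<close>
      then show "dist (orb t e) (orb t e') \<le> \<eta> / 2"
        using Z(2)[OF e(1), of t] Z(2)[OF e(2), of t] eta_pos
          dist_triangle[of "orb t e" "orb t (g (Z e'))" "orb t (g (Z e))"]
          dist_triangle2[of "orb t e" "orb t e'" "orb t (g (Z e'))"] by linarith
    qed
    then show "p = p'" using ii p by blast
  qed
  have "\<Phi> ` (E \<times> {..<N}) \<subseteq> E \<times> P \<times> P \<times> Q"
  proof (rule image_subsetI)
    fix p assume "p \<in> E \<times> {..<N}"
    then obtain e i where p: "p = (e, i)" and "e \<in> E" by auto
    then have "W e i \<in> ?D" "Z e \<in> ?D" using W(1) Z(1) by auto
    moreover from this have "W e i \<in> X" "Z e \<in> X" using DX by auto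
    ultimately show "\<Phi> p \<in> E \<times> P \<times> P \<times> Q"
      using V(1) P(2) Q(2) orb_in p by (simp add: \<Phi>_def)
  qed
  then have "card (E \<times> {..<N}) \<le> card (E \<times> P \<times> P \<times> Q)"
    using inj E(1) P(1) Q(1) by (intro card_inj_on_le) auto
  then have "card E * N \<le> card E * (card P * card P * card Q)"
    by (simp add: card_cartesian_product mult.assoc)
  \<comment> \<open>\<open>E\<close> is nonempty because it spans the class of \<open>x\<close>; so
    \<open>card E\<close> cancels and \<open>N\<close> is bounded by the number of labels.\<close>
  moreover have "card E > 0" using E(1,4) xD by (force simp: card_gt_0_iff)
  ultimately show False by (simp add: N_def)
qed

text \<open>A periodic point \<open>q\<close> within \<open>\<rho>\<close> of \<open>x\<close> puts
  \<open>x\<close> in the class of \<open>q\<close>. A positive power of \<open>\<tau>\<close> maps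
  this class onto itself and still identifies \<open>x\<close> and \<open>y\<close>.\<close>

lemma moore_property: "moore_property X f"
  unfolding moore_property_def pre_injective_def
proof (intro allI impI ballI inj_onI)
  fix \<tau> x0 x y assume \<tau>: "endomorphism X f \<tau>" "\<tau> ` X = X" and x0: "x0 \<in> X"
    and xy: "x \<in> homoclinicity_class X f x0" "y \<in> homoclinicity_class X f x0" and eq: "\<tau> x = \<tau> y"
  have X: "x \<in> X" "y \<in> X" using xy by (auto simp: homoclinicity_class_def)
  have hom: "homoclinic X f x y"
    unfolding homoclinic_def
  proof (rule tendsto_sandwich[OF always_eventually always_eventually tendsto_const])
    have "((\<lambda>n. dist (orb n x0) (orb n x) + dist (orb n x0) (orb n y)) \<longlongrightarrow> 0 + 0) (filtercomap abs at_top)"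
      by (intro tendsto_add) (use xy in \<open>auto simp: homoclinicity_class_def homoclinic_def\<close>)
    then show "((\<lambda>n. dist (orb n x0) (orb n x) + dist (orb n x0) (orb n y)) \<longlongrightarrow> 0) (filtercomap abs at_top)"
      by simp
  qed (auto intro: dist_triangle3)
  obtain \<rho> where \<rho>: "\<rho> > 0" "\<And>s a b. \<lbrakk>s > 0; a \<in> X; b \<in> X; dist a b \<le> \<rho>\<rbrakk> \<Longrightarrow> eqv s a b"
    using eqv_near by metis
  obtain q s where q: "q \<in> X" "s > 0" "orb (int s) q = q" "dist x q \<le> \<rho>"
    by (rule periodic_dense[OF X(1) \<rho>(1)]) blast
  have "eqv s q x" using \<rho>(2) q X by (simp add: dist_commute)
  obtain k where k: "k > 0" "(\<tau> ^^ k) ` {a. eqv s q a} = {a. eqv s q a}"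
    by (rule power_fixes_class[OF \<tau> q(2), of q]) blast
  have "(\<tau> ^^ k) x = (\<tau> ^^ k) y"
    using k(1) eq by (cases k) (simp_all add: funpow_Suc_right del: funpow.simps)
  then show "x = y"
    using no_collapsed_homoclinic_pair[OF endomorphism_funpow[OF \<tau>(1)] q(2,1,3) k(2) \<open>eqv s q x\<close> X(2) hom]
    by blast
qed

end

theorem theorem1p3:
  fixes X :: "'a::metric_space set" and f :: "'a \<Rightarrow> 'a"
  assumes "smale_space X f" and "non_wandering X f"
  shows "surjunctive X f \<and> moore_property X f"
proof -
  obtain \<eta> where "\<eta> > 0"
    "\<forall>x\<in>X. \<forall>y\<in>X. x \<noteq> y \<longrightarrow> (\<exists>n. dist (iter X f n x) (iter X f n y) > \<eta>)"
    using assms(1) unfolding smale_space_def expansive_def by blast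
  then interpret nonwandering_smale X f \<eta>
    by unfold_locales (use assms in \<open>auto simp: smale_space_def not_less[symmetric]\<close>)
  show ?thesis using surjunctive moore_property by blast
qed

end
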